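(* Let $n\geq 3$ and $m\geq 2$. Let $(M^{n},g)$ be a compact Riemannian manifold with scalar curvature $R$, let $(N^{m},\tilde g)$ be a semi-Riemannian manifold, and let $f:M\to(0,+\infty)$ be a smooth function. Suppose that the warped product $(\widehat M^{n+m},\hat g)=(M^{n},g)\times_f(N^{m},\tilde g)$ is Einstein with $\widehat{Ric}=\lambda\hat g$ for a constant $\lambda\neq 0$, and that $R\leq\lambda(n-m)$ on $M$. Then $\widehat M$ is a product manifold, i.e. $f$ is trivial (constant). Moreover, if the equality $R=\lambda(n-m)$ holds, then $N$ is Ricci-flat.
   Context: The warped product $(M^{n},g)\times_f(N^{m},\tilde g)$ is the product manifold $M\times N$ endowed with the metric $\hat g=g+f^{2}\tilde g$; $M$ is the base, $N$ the fiber and $f$ the warping function. $\widehat{Ric}$ is the Ricci tensor of $\hat g$. Manifolds are connected and without boundary. *)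

theory Defs
  imports "HOL-Analysis.Analysis"
begin

section \<open>Smooth maps between Euclidean spaces\<close>

text \<open>The set \<open>S\<close> is always open in what follows. All directional derivatives are taken,
  which is the same as taking all partial derivatives.\<close>

fun Ck_on :: "nat \<Rightarrow> ('e::euclidean_space \<Rightarrow> 'v::real_normed_vector) \<Rightarrow> 'e set \<Rightarrow> bool" where
  "Ck_on 0 F S \<longleftrightarrow> continuous_on S F"
| "Ck_on (Suc k) F S \<longleftrightarrow>
     (\<forall>x\<in>S. F differentiable (at x)) \<and>
     (\<forall>u. Ck_on k (\<lambda>x. frechet_derivative F (at x) u) S)"

definition smooth_on :: "('e::euclidean_space \<Rightarrow> 'v::real_normed_vector) \<Rightarrow> 'e set \<Rightarrow> bool" where
  "smooth_on F S \<longleftrightarrow> (\<forall>k. Ck_on k F S)"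


section \<open>Smooth manifolds\<close>

text \<open>A manifold is given by its topology and a smooth atlas, i.e. a family of charts
  \<open>cmap M i : cdom M i \<rightarrow> 'e\<close>, \<open>i \<in> cidx M\<close>. The model space is a Euclidean space \<open>'e\<close>, so that
  the dimension of the manifold is \<open>DIM('e)\<close>. The atlas need not be maximal.
  Having the charts indexed makes the product atlas a family over the product of the index sets.\<close>

record ('a, 'i, 'e) atlas =
  mtop :: "'a topology"
  cidx :: "'i set"
  cdom :: "'i \<Rightarrow> 'a set"
  cmap :: "'i \<Rightarrow> 'a \<Rightarrow> 'e"

abbreviation points :: "('a, 'i, 'e) atlas \<Rightarrow> 'a set" where
  "points M \<equiv> topspace (mtop M)"

definition cimg :: "('a, 'i, 'e) atlas \<Rightarrow> 'i \<Rightarrow> 'e set" where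
  "cimg M i = cmap M i ` cdom M i"

definition cinv :: "('a, 'i, 'e) atlas \<Rightarrow> 'i \<Rightarrow> 'e \<Rightarrow> 'a" where
  "cinv M i = inv_into (cdom M i) (cmap M i)"

text \<open>Manifolds are without boundary (chart images are open in \<open>'e\<close>), connected and nonempty.\<close>

definition smooth_manifold :: "('a, 'i, 'e::euclidean_space) atlas \<Rightarrow> bool" where
  "smooth_manifold M \<longleftrightarrow>
     Hausdorff_space (mtop M) \<and> second_countable (mtop M) \<and>
     connected_space (mtop M) \<and> points M \<noteq> {} \<and>
     (\<Union>i\<in>cidx M. cdom M i) = points M \<and>
     (\<forall>i\<in>cidx M. openin (mtop M) (cdom M i) \<and> open (cimg M i) \<and>
        homeomorphic_map (subtopology (mtop M) (cdom M i)) (top_of_set (cimg M i)) (cmap M i)) \<and>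
     (\<forall>i\<in>cidx M. \<forall>j\<in>cidx M.
        smooth_on (cmap M j \<circ> cinv M i) (cmap M i ` (cdom M i \<inter> cdom M j)))"

definition smooth_function :: "('a, 'i, 'e::euclidean_space) atlas \<Rightarrow> ('a \<Rightarrow> real) \<Rightarrow> bool" where
  "smooth_function M f \<longleftrightarrow> (\<forall>i\<in>cidx M. smooth_on (f \<circ> cinv M i) (cimg M i))"

definition product_manifold ::
  "('a, 'i, 'e) atlas \<Rightarrow> ('b, 'j, 'd) atlas \<Rightarrow> ('a \<times> 'b, 'i \<times> 'j, 'e \<times> 'd) atlas" where
  "product_manifold M N =
     \<lparr>mtop = prod_topology (mtop M) (mtop N),
      cidx = cidx M \<times> cidx N,
      cdom = (\<lambda>(i, j). cdom M i \<times> cdom N j),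
      cmap = (\<lambda>(i, j) (p, q). (cmap M i p, cmap N j q))\<rparr>"


section \<open>Metric tensors\<close>

text \<open>A covariant 2-tensor field is given by its components in the charts: \<open>T i p u v\<close> is
  the value at \<open>p \<in> cdom M i\<close> on the tangent vectors whose coordinates with respect to
  the chart \<open>i\<close> are \<open>u\<close> and \<open>v\<close>.\<close>

type_synonym ('a, 'i, 'e) tensor2 = "'i \<Rightarrow> 'a \<Rightarrow> 'e \<Rightarrow> 'e \<Rightarrow> real"

definition in_coords ::
  "('a, 'i, 'e) atlas \<Rightarrow> ('a, 'i, 'e) tensor2 \<Rightarrow> 'i \<Rightarrow> 'e \<Rightarrow> 'e \<Rightarrow> 'e \<Rightarrow> real" where
  "in_coords M T i x = T i (cinv M i x)"

definition smooth_tensor2 ::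
  "('a, 'i, 'e::euclidean_space) atlas \<Rightarrow> ('a, 'i, 'e) tensor2 \<Rightarrow> bool" where
  "smooth_tensor2 M T \<longleftrightarrow>
     (\<forall>i\<in>cidx M. \<forall>p\<in>cdom M i. bilinear (T i p)) \<and>
     (\<forall>i\<in>cidx M. \<forall>j\<in>cidx M. \<forall>p\<in>cdom M i \<inter> cdom M j. \<forall>u v.
        let D = frechet_derivative (cmap M j \<circ> cinv M i) (at (cmap M i p))
        in T i p u v = T j p (D u) (D v)) \<and>
     (\<forall>i\<in>cidx M. \<forall>u v. smooth_on (\<lambda>x. in_coords M T i x u v) (cimg M i))"

definition symmetric_tensor2 ::
  "('a, 'i, 'e) atlas \<Rightarrow> ('a, 'i, 'e) tensor2 \<Rightarrow> bool" where
  "symmetric_tensor2 M T \<longleftrightarrow> (\<forall>i\<in>cidx M. \<forall>p\<in>cdom M i. \<forall>u v. T i p u v = T i p v u)"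

definition riemannian_metric ::
  "('a, 'i, 'e::euclidean_space) atlas \<Rightarrow> ('a, 'i, 'e) tensor2 \<Rightarrow> bool" where
  "riemannian_metric M g \<longleftrightarrow>
     smooth_tensor2 M g \<and> symmetric_tensor2 M g \<and>
     (\<forall>i\<in>cidx M. \<forall>p\<in>cdom M i. \<forall>u. u \<noteq> 0 \<longrightarrow> g i p u u > 0)"

definition form_index :: "('e::euclidean_space \<Rightarrow> 'e \<Rightarrow> real) \<Rightarrow> nat" where
  "form_index B = Max (dim ` {W. subspace W \<and> (\<forall>w\<in>W. w \<noteq> 0 \<longrightarrow> B w w < 0)})"

definition semi_riemannian_metric ::
  "('a, 'i, 'e::euclidean_space) atlas \<Rightarrow> ('a, 'i, 'e) tensor2 \<Rightarrow> bool" where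
  "semi_riemannian_metric M g \<longleftrightarrow>
     smooth_tensor2 M g \<and> symmetric_tensor2 M g \<and>
     (\<forall>i\<in>cidx M. \<forall>p\<in>cdom M i. \<forall>u. (\<forall>v. g i p u v = 0) \<longrightarrow> u = 0) \<and>
     (\<exists>\<nu>. \<forall>i\<in>cidx M. \<forall>p\<in>cdom M i. form_index (g i p) = \<nu>)"


section \<open>Curvature\<close>

text \<open>In this block \<open>h\<close> is a metric on an open subset of \<open>'e\<close>.\<close>

text \<open>The vector metrically equivalent to the linear form \<open>\<alpha>\<close> (raising an index).\<close>

definition sharp :: "('e \<Rightarrow> 'e \<Rightarrow> real) \<Rightarrow> ('e \<Rightarrow> real) \<Rightarrow> 'e" where
  "sharp B \<alpha> = (THE w. \<forall>z. B w z = \<alpha> z)"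

text \<open>\<open>christoffel h x e\<^sub>i e\<^sub>j\<close> is the vector with components \<open>\<Gamma>\<^sup>k\<^sub>i\<^sub>j =
  1/2 \<Sum>\<^sub>l h\<^sup>k\<^sup>l (\<partial>\<^sub>i h\<^sub>j\<^sub>l + \<partial>\<^sub>j h\<^sub>i\<^sub>l - \<partial>\<^sub>l h\<^sub>i\<^sub>j)\<close>.\<close>

definition christoffel ::
  "('e::euclidean_space \<Rightarrow> 'e \<Rightarrow> 'e \<Rightarrow> real) \<Rightarrow> 'e \<Rightarrow> 'e \<Rightarrow> 'e \<Rightarrow> 'e" where
  "christoffel h x u v = sharp (h x) (\<lambda>z.
     (frechet_derivative (\<lambda>y. h y v z) (at x) u
      + frechet_derivative (\<lambda>y. h y u z) (at x) v
      - frechet_derivative (\<lambda>y. h y u v) (at x) z) / 2)"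

text \<open>\<open>riemann h x z u v = \<nabla>\<^sub>z \<nabla>\<^sub>u v - \<nabla>\<^sub>u \<nabla>\<^sub>z v\<close> for constant (hence commuting)
  coordinate vector fields.\<close>

definition riemann ::
  "('e::euclidean_space \<Rightarrow> 'e \<Rightarrow> 'e \<Rightarrow> real) \<Rightarrow> 'e \<Rightarrow> 'e \<Rightarrow> 'e \<Rightarrow> 'e \<Rightarrow> 'e" where
  "riemann h x z u v =
     frechet_derivative (\<lambda>y. christoffel h y u v) (at x) z
     - frechet_derivative (\<lambda>y. christoffel h y z v) (at x) u
     + christoffel h x z (christoffel h x u v)
     - christoffel h x u (christoffel h x z v)"

text \<open>The trace of the endomorphism \<open>z \<mapsto> riemann h x z u v\<close>; with this sign convention
  round spheres have positive Ricci curvature. The trace does not depend on the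
  basis, so the Euclidean inner product of \<open>'e\<close> plays no role here.\<close>

definition local_ricci ::
  "('e::euclidean_space \<Rightarrow> 'e \<Rightarrow> 'e \<Rightarrow> real) \<Rightarrow> 'e \<Rightarrow> 'e \<Rightarrow> 'e \<Rightarrow> real" where
  "local_ricci h x u v = (\<Sum>b\<in>Basis. riemann h x b u v \<bullet> b)"

definition ricci ::
  "('a, 'i, 'e::euclidean_space) atlas \<Rightarrow> ('a, 'i, 'e) tensor2 \<Rightarrow> ('a, 'i, 'e) tensor2" where
  "ricci M g i p = local_ricci (in_coords M g i) (cmap M i p)"

text \<open>The trace \<open>\<Sum>\<^sub>k\<^sub>l B\<^sup>k\<^sup>l T\<^sub>k\<^sub>l\<close> of \<open>T\<close> with respect to the nondegenerate form \<open>B\<close>.\<close>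

definition metric_trace ::
  "('e::euclidean_space \<Rightarrow> 'e \<Rightarrow> real) \<Rightarrow> ('e \<Rightarrow> 'e \<Rightarrow> real) \<Rightarrow> real" where
  "metric_trace B T = (\<Sum>b\<in>Basis. sharp B (T b) \<bullet> b)"

text \<open>The metric trace of a tensor is independent of the chart, so any chart around the
  point may be used.\<close>

definition chart_at :: "('a, 'i, 'e) atlas \<Rightarrow> 'a \<Rightarrow> 'i" where
  "chart_at M p = (SOME i. i \<in> cidx M \<and> p \<in> cdom M i)"

definition scalar_curvature ::
  "('a, 'i, 'e::euclidean_space) atlas \<Rightarrow> ('a, 'i, 'e) tensor2 \<Rightarrow> 'a \<Rightarrow> real" where
  "scalar_curvature M g p =
     metric_trace (g (chart_at M p) p) (ricci M g (chart_at M p) p)"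

definition einstein ::
  "('a, 'i, 'e::euclidean_space) atlas \<Rightarrow> ('a, 'i, 'e) tensor2 \<Rightarrow> real \<Rightarrow> bool" where
  "einstein M g c \<longleftrightarrow> (\<forall>i\<in>cidx M. \<forall>p\<in>cdom M i. \<forall>u v. ricci M g i p u v = c * g i p u v)"

definition ricci_flat ::
  "('a, 'i, 'e::euclidean_space) atlas \<Rightarrow> ('a, 'i, 'e) tensor2 \<Rightarrow> bool" where
  "ricci_flat M g \<longleftrightarrow> (\<forall>i\<in>cidx M. \<forall>p\<in>cdom M i. \<forall>u v. ricci M g i p u v = 0)"


section \<open>Warped products\<close>

text \<open>The metric \<open>g + f\<^sup>2 h\<close> on \<open>product_manifold M N\<close>, for \<open>g\<close> on the base \<open>M\<close>,
  \<open>h\<close> on the fiber \<open>N\<close> and the warping function \<open>f\<close> on \<open>M\<close>.\<close>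

definition warped_metric ::
  "('a, 'i, 'e) tensor2 \<Rightarrow> ('a \<Rightarrow> real) \<Rightarrow> ('b, 'j, 'd) tensor2 \<Rightarrow>
   ('a \<times> 'b, 'i \<times> 'j, 'e \<times> 'd) tensor2" where
  "warped_metric g f h = (\<lambda>(i, j) (p, q) (u, u') (v, v'). g i p u v + (f p)\<^sup>2 * h j q u' v')"

end

theory Submission
  imports Defs
begin

text \<open>
  Let \<open>n\<close> and \<open>m\<close> be the dimensions of base and fiber. By the warped product formulas, the Einstein
  equation splits into a horizontal part \<open>Ric - (m/f) Hess f = lam g\<close> and a vertical part which says
  that the fiber is Einstein: \<open>Ric\<^sub>N = \<mu> h\<close> with
  \<open>\<mu> = lam f\<^sup>2 + f \<Delta>f + (m - 1) \<bar>\<nabla>f\<bar>\<^sup>2\<close>, a constant because it does not depend on the point of the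
  base while \<open>Ric\<^sub>N\<close> and \<open>h\<close> live on the fiber. Tracing the horizontal part yields
  \<open>R = lam n + m \<Delta>f / f\<close>.

  Both equations are evaluated only at a minimum \<open>p\<^sub>0\<close> and a maximum \<open>p\<^sub>1\<close> of \<open>f\<close>, which exist by
  compactness, and where \<open>\<Delta>f \<ge> 0\<close> and \<open>\<Delta>f \<le> 0\<close> respectively.

  \<^item> If \<open>lam > 0\<close>, then \<open>R \<ge> lam n > lam (n - m)\<close> at \<open>p\<^sub>0\<close>, against the hypothesis.
  \<^item> If \<open>lam < 0\<close>, comparing the two values of \<open>\<mu>\<close> gives
    \<open>lam f(p\<^sub>0)\<^sup>2 \<le> \<mu> \<le> lam f(p\<^sub>1)\<^sup>2\<close>, whence \<open>f(p\<^sub>1) \<le> f(p\<^sub>0)\<close> and \<open>f\<close> is constant. Moreover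
    \<open>R \<le> lam n < lam (n - m)\<close> at \<open>p\<^sub>1\<close>, so equality in the curvature bound never occurs and the claim
    about Ricci-flatness holds for that reason.

  Working at critical points of \<open>f\<close> pays off in the computation of the curvature
  (\<open>local_ricci_K_critical\<close>): every term containing a first derivative of \<open>f\<close> disappears, and the
  Hessian is the matrix of second coordinate derivatives. The connection must still be known
  near the point, since it is differentiated; this rests on the differentiability of vectors obtained
  by raising an index (\<open>differentiable_sharp\<close>) and on the formula \<open>christoffel_K\<close>. The sign of the
  Laplacian comes from the second derivative test along lines (\<open>second_derivative_at_extremum\<close>)
  and from writing the trace in a frame orthonormal for the metric
  (\<open>metric_trace_nonneg\<close>). All of this is combined in \<open>einstein_warped_product_at_extremum\<close>.
\<close>

section \<open>Raising an index\<close>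

definition nondegenerate :: "('e::euclidean_space \<Rightarrow> 'e \<Rightarrow> real) \<Rightarrow> bool" where
  "nondegenerate B \<longleftrightarrow> bilinear B \<and> (\<forall>u. (\<forall>v. B u v = 0) \<longrightarrow> u = 0)"

lemma nondegenerate_bilinear: "nondegenerate B \<Longrightarrow> bilinear B"
  by (simp add: nondegenerate_def)

lemma linear_bilinear_left: "bilinear B \<Longrightarrow> linear (\<lambda>u. B u v)"
  and linear_bilinear_right: "bilinear B \<Longrightarrow> linear (\<lambda>v. B u v)"
  by (simp_all add: bilinear_def)

lemma linear_eq_sum_Basis:
  fixes \<alpha> :: "'e::euclidean_space \<Rightarrow> 'v::real_vector"
  assumes "linear \<alpha>"
  shows "\<alpha> z = (\<Sum>b\<in>Basis. (z \<bullet> b) *\<^sub>R \<alpha> b)"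
proof -
  have "\<alpha> z = \<alpha> (\<Sum>b\<in>Basis. (z \<bullet> b) *\<^sub>R b)" by (simp add: euclidean_representation)
  also have "\<dots> = (\<Sum>b\<in>Basis. (z \<bullet> b) *\<^sub>R \<alpha> b)"
    using assms by (simp add: linear_sum linear_scale)
  finally show ?thesis .
qed

lemma nondegenerate_cancel:
  assumes "nondegenerate B" and "\<And>z. B w z = B w' z"
  shows "w = w'"
proof -
  have "bilinear B" using assms(1) by (simp add: nondegenerate_def)
  then have "B (w - w') z = 0" for z
    by (simp add: bilinear_lsub assms(2))
  then show ?thesis using assms(1) unfolding nondegenerate_def by (metis eq_iff_diff_eq_0)
qed

lemma sharp_eqI:
  assumes "nondegenerate B" and "\<And>z. B w z = \<alpha> z"
  shows "sharp B \<alpha> = w"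
  unfolding sharp_def
proof (rule the_equality)
  show "\<forall>z. B w z = \<alpha> z" using assms(2) by blast
  show "w' = w" if "\<forall>z. B w' z = \<alpha> z" for w'
    using nondegenerate_cancel[OF assms(1), of w' w] that assms(2) by simp
qed

text \<open>A nondegenerate form identifies vectors with linear functionals because the linear map it induces
  into the dual is injective between spaces of equal dimension. This makes the definite description
  in \<^const>\<open>sharp\<close> meaningful.\<close>

lemma sharp_works:
  fixes B :: "'e::euclidean_space \<Rightarrow> 'e \<Rightarrow> real"
  assumes B: "nondegenerate B" and \<alpha>: "linear \<alpha>"
  shows "B (sharp B \<alpha>) z = \<alpha> z"
proof -
  have bil: "bilinear B" using B by (simp add: nondegenerate_def)
  define L where "L w = (\<Sum>b\<in>Basis. B w b *\<^sub>R b)" for w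
  have L: "L w \<bullet> b = B w b" if "b \<in> Basis" for w b
    using that by (simp add: L_def)
  have "linear L"
    by (rule linearI)
      (simp_all add: L_def bilinear_ladd[OF bil] bilinear_lmul[OF bil] scaleR_add_left
        sum.distrib scaleR_sum_right)
  have Beq: "B w z = L w \<bullet> z" for w z
    unfolding linear_eq_sum_Basis[OF linear_bilinear_right[OF bil], of w z] L_def
    by (simp add: inner_sum_left inner_sum_right mult.commute inner_commute)
  have "inj L"
  proof (rule injI)
    fix v w assume "L v = L w"
    then show "v = w" by (intro nondegenerate_cancel[OF B]) (simp add: Beq)
  qed
  then have "surj L" using \<open>linear L\<close> by (simp add: linear_injective_imp_surjective)
  then obtain w where w: "L w = (\<Sum>b\<in>Basis. \<alpha> b *\<^sub>R b)" by (metis surjD)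
  have "B w z = \<alpha> z" for z
    unfolding Beq w linear_eq_sum_Basis[OF \<alpha>, of z] inner_sum_left
    by (intro sum.cong) (auto simp: inner_commute)
  then show ?thesis using sharp_eqI[OF B, of w \<alpha>] by simp
qed

lemma sharp_zero: "nondegenerate B \<Longrightarrow> sharp B (\<lambda>z. 0) = 0"
  by (intro sharp_eqI) (auto simp: nondegenerate_def bilinear_lzero)

text \<open>The expansion isolates the dependence on the functional: the vectors on the right involve the
  form only. It is what allows a varying form to be compared with one frozen at a point.\<close>

lemma sharp_expansion:
  fixes B :: "'e::euclidean_space \<Rightarrow> 'e \<Rightarrow> real"
  assumes B: "nondegenerate B" and \<alpha>: "linear \<alpha>"
  shows "sharp B \<alpha> = (\<Sum>b\<in>Basis. \<alpha> b *\<^sub>R sharp B (\<lambda>z. b \<bullet> z))"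
proof (rule sharp_eqI[OF B])
  fix z
  have bil: "bilinear B" using B by (simp add: nondegenerate_def)
  have "B (\<Sum>b\<in>Basis. \<alpha> b *\<^sub>R sharp B (\<lambda>z. b \<bullet> z)) z
      = (\<Sum>b\<in>Basis. \<alpha> b * B (sharp B (\<lambda>z. b \<bullet> z)) z)"
    by (simp add: linear_sum[OF linear_bilinear_left[OF bil]] bilinear_lmul[OF bil])
  also have "\<dots> = (\<Sum>b\<in>Basis. \<alpha> b * (b \<bullet> z))"
    using sharp_works[OF B] by (simp add: bounded_linear.linear bounded_linear_inner_right)
  also have "\<dots> = \<alpha> z"
    by (subst (2) linear_eq_sum_Basis[OF \<alpha>]) (simp add: inner_commute mult.commute)
  finally show "B (\<Sum>b\<in>Basis. \<alpha> b *\<^sub>R sharp B (\<lambda>z. b \<bullet> z)) z = \<alpha> z" .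
qed

text \<open>Continuity of the second factor is enough where the first one vanishes, since the increment of
  the second factor is then multiplied by a quantity of first order. This breaks the circularity in
  the next lemma, where the second factor is the function whose differentiability is in question.\<close>

lemma differentiable_mult_vanishing_left:
  fixes p w :: "'e::euclidean_space \<Rightarrow> real"
  assumes p: "p differentiable (at x)" and "p x = 0" and w: "isCont w x"
  shows "(\<lambda>y. p y * w y) differentiable (at x)"
proof -
  obtain p' where p': "(p has_derivative p') (at x)" using p by (auto simp: differentiable_def)
  then have lin: "bounded_linear p'" by (rule has_derivative_bounded_linear)
  obtain K where K: "\<And>h. norm (p' h) \<le> norm h * K"
    using lin bounded_linear.bounded by blast
  have "((\<lambda>y. p y * w y) has_derivative (\<lambda>h. p' h * w x)) (at x)"
    unfolding has_derivative_at_within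
  proof (intro conjI)
    show "bounded_linear (\<lambda>h. p' h * w x)" using lin by (rule bounded_linear_mult_const)
    have 1: "((\<lambda>y. (p y - p x - p' (y - x)) /\<^sub>R norm (y - x)) \<longlongrightarrow> 0) (at x)"
      using p' unfolding has_derivative_at_within by blast
    have wx: "(w \<longlongrightarrow> w x) (at x)" using w by (simp add: isCont_def)
    have 2: "((\<lambda>y. (p y - p x - p' (y - x)) /\<^sub>R norm (y - x) * w y) \<longlongrightarrow> 0) (at x)"
      using tendsto_mult[OF 1 wx] by simp
    have 3: "((\<lambda>y. (p' (y - x) / norm (y - x)) * (w y - w x)) \<longlongrightarrow> 0) (at x)"
    proof (rule Lim_null_comparison)
      show "\<forall>\<^sub>F y in at x. norm ((p' (y - x) / norm (y - x)) * (w y - w x)) \<le> \<bar>K\<bar> * \<bar>w y - w x\<bar>"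
      proof (rule eventuallyI)
        fix y
        have "\<bar>p' (y - x)\<bar> \<le> norm (y - x) * \<bar>K\<bar>"
          using K[of "y - x"] by (smt (verit) mult_left_mono norm_ge_zero real_norm_def)
        then have "\<bar>p' (y - x)\<bar> / norm (y - x) \<le> \<bar>K\<bar>"
          by (cases "y = x") (simp_all add: field_simps)
        then show "norm ((p' (y - x) / norm (y - x)) * (w y - w x)) \<le> \<bar>K\<bar> * \<bar>w y - w x\<bar>"
          using mult_right_mono[of "\<bar>p' (y - x)\<bar> / norm (y - x)" "\<bar>K\<bar>" "\<bar>w y - w x\<bar>"]
          by (simp add: abs_mult)
      qed
      have "((\<lambda>y. \<bar>K\<bar> * \<bar>w y - w x\<bar>) \<longlongrightarrow> \<bar>K\<bar> * \<bar>w x - w x\<bar>) (at x)"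
        by (intro tendsto_intros wx)
      then show "((\<lambda>y. \<bar>K\<bar> * \<bar>w y - w x\<bar>) \<longlongrightarrow> 0) (at x)" by simp
    qed
    have "((\<lambda>y. (p y - p x - p' (y - x)) /\<^sub>R norm (y - x) * w y
         + (p' (y - x) / norm (y - x)) * (w y - w x)) \<longlongrightarrow> 0) (at x)"
      using tendsto_add[OF 2 3] by simp
    then show "((\<lambda>y. (p y * w y - p x * w x - p' (y - x) * w x) /\<^sub>R norm (y - x)) \<longlongrightarrow> 0) (at x)"
      by (rule Lim_transform_eventually)
        (simp add: \<open>p x = 0\<close> divide_inverse algebra_simps)
  qed
  then show ?thesis by (auto simp: differentiable_def)
qed

text \<open>Differentiability of matrix inversion, in the form needed for Christoffel symbols and gradients.
  Write \<open>w y\<close> for the vector in question and freeze the form at \<open>x\<close>. Then \<open>w y\<close> solves the fixed point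
  equation \<open>w y = a y - Q y (w y)\<close>, where \<open>a\<close> is differentiable, and \<open>Q y\<close> is linear with
  coefficients that are differentiable and vanish at \<open>x\<close>. As \<open>Q y\<close> is small near \<open>x\<close>, the equation first
  bounds \<open>w\<close>, hence gives its continuity at \<open>x\<close>, and then its differentiability.\<close>

lemma differentiable_sharp:
  fixes B :: "'e::euclidean_space \<Rightarrow> 'e \<Rightarrow> 'e \<Rightarrow> real"
  assumes U: "open U" "x \<in> U"
    and nd: "\<And>y. y \<in> U \<Longrightarrow> nondegenerate (B y)"
    and lin: "\<And>y. y \<in> U \<Longrightarrow> linear (\<alpha> y)"
    and dB: "\<And>u v. (\<lambda>y. B y u v) differentiable (at x)"
    and d\<alpha>: "\<And>z. (\<lambda>y. \<alpha> y z) differentiable (at x)"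
  shows "(\<lambda>y. sharp (B y) (\<alpha> y)) differentiable (at x)"
proof -
  define w where "w y = sharp (B y) (\<alpha> y)" for y
  define E where "E c = sharp (B x) (\<lambda>z. c \<bullet> z)" for c
  define p where "p c d y = B y d c - B x d c" for c d y
  define W where "W y = (\<Sum>c\<in>Basis. (\<alpha> y c - (\<Sum>d\<in>Basis. p c d y * (w y \<bullet> d))) *\<^sub>R E c)" for y
  \<comment> \<open>The fixed point equation; \<open>W\<close> still contains \<open>w\<close>.\<close>
  have w_eq: "w y = W y" if "y \<in> U" for y
  proof -
    have bx: "bilinear (B x)" and bil_y: "bilinear (B y)"
      using nd that U by (auto simp: nondegenerate_def)
    have "w y = sharp (B x) (B x (w y))"
      by (rule sharp_eqI[symmetric]) (use nd U in auto)
    also have "\<dots> = (\<Sum>c\<in>Basis. B x (w y) c *\<^sub>R E c)"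
      unfolding E_def by (rule sharp_expansion) (use nd U bx in \<open>auto simp: bilinear_def\<close>)
    also have "\<dots> = W y"
      unfolding W_def
    proof (intro sum.cong refl arg_cong2[where f=scaleR])
      fix c :: 'e
      have "(\<Sum>d\<in>Basis. p c d y * (w y \<bullet> d)) = B y (w y) c - B x (w y) c"
        unfolding linear_eq_sum_Basis[OF linear_bilinear_left[OF bx], of "w y" c]
          linear_eq_sum_Basis[OF linear_bilinear_left[OF bil_y], of "w y" c]
        by (simp add: p_def sum_subtractf[symmetric] algebra_simps)
      moreover have "B y (w y) c = \<alpha> y c"
        unfolding w_def using sharp_works nd lin that by blast
      ultimately show "B x (w y) c = \<alpha> y c - (\<Sum>d\<in>Basis. p c d y * (w y \<bullet> d))" by simp
    qed
    finally show ?thesis .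
  qed
  have dp: "p c d differentiable (at x)" for c d
    unfolding p_def by (intro derivative_intros dB)
  have px: "p c d x = 0" for c d by (simp add: p_def)
  have cp: "(p c d \<longlongrightarrow> 0) (at x)" for c d
    using differentiable_imp_continuous_within[OF dp, of c d] px by (metis isCont_def)
  define a where "a y = (\<Sum>c\<in>Basis. \<alpha> y c *\<^sub>R E c)" for y
  define q where "q y = (\<Sum>c\<in>Basis. \<Sum>d\<in>Basis. \<bar>p c d y\<bar> * norm (E c))" for y
  have da: "a differentiable (at x)"
    unfolding a_def by (intro differentiable_sum ballI differentiable_scaleR d\<alpha> differentiable_const) auto
  have ca: "(a \<longlongrightarrow> a x) (at x)"
    using differentiable_imp_continuous_within[OF da] by (simp add: isCont_def)
  have cq: "(q \<longlongrightarrow> 0) (at x)"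
  proof -
    have "(q \<longlongrightarrow> (\<Sum>c\<in>Basis. \<Sum>d\<in>(Basis::'e set). \<bar>0::real\<bar> * norm (E c))) (at x)"
      unfolding q_def by (intro tendsto_sum tendsto_mult tendsto_rabs tendsto_const cp)
    then show ?thesis by simp
  qed
  \<comment> \<open>\<open>q y\<close> bounds the operator norm of the linear map called \<open>Q y\<close> above.\<close>
  have wa: "norm (w y - a y) \<le> q y * norm (w y)" if "y \<in> U" for y
  proof -
    have "norm (w y - a y) = norm (\<Sum>c\<in>Basis. (\<Sum>d\<in>Basis. p c d y * (w y \<bullet> d)) *\<^sub>R E c)"
    proof -
      have "W y - a y = - (\<Sum>c\<in>Basis. (\<Sum>d\<in>Basis. p c d y * (w y \<bullet> d)) *\<^sub>R E c)"
        unfolding W_def a_def by (simp add: sum_subtractf scaleR_diff_left)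
      then show ?thesis by (subst (1) w_eq[OF that]) simp
    qed
    also have "\<dots> \<le> (\<Sum>c\<in>Basis. (\<Sum>d\<in>Basis. \<bar>p c d y\<bar> * norm (w y)) * norm (E c))"
    proof (rule sum_norm_le)
      fix c :: 'e
      have "\<bar>\<Sum>d\<in>Basis. p c d y * (w y \<bullet> d)\<bar> \<le> (\<Sum>d\<in>Basis. \<bar>p c d y\<bar> * norm (w y))"
        by (rule order_trans[OF sum_abs])
          (auto intro!: sum_mono mult_left_mono simp: abs_mult Basis_le_norm)
      then show "norm ((\<Sum>d\<in>Basis. p c d y * (w y \<bullet> d)) *\<^sub>R E c)
          \<le> (\<Sum>d\<in>Basis. \<bar>p c d y\<bar> * norm (w y)) * norm (E c)"
        by (simp add: mult_right_mono)
    qed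
    also have "\<dots> = q y * norm (w y)"
      unfolding q_def sum_distrib_right by (intro sum.cong refl) (simp add: mult_ac)
    finally show ?thesis .
  qed
  have wx: "w x = a x" using wa[OF U(2)] by (simp add: q_def px)
  have evU: "\<forall>\<^sub>F y in at x. y \<in> U" using U by (metis eventually_at_topological)
  \<comment> \<open>Any bound below 1 makes the term \<open>q y * norm (w y)\<close> absorbable into \<open>norm (w y)\<close>.\<close>
  have evq: "\<forall>\<^sub>F y in at x. q y < 1/2" using cq by (rule order_tendstoD) simp
  have lim_wa: "((\<lambda>y. w y - a y) \<longlongrightarrow> 0) (at x)"
  proof (rule Lim_null_comparison)
    show "\<forall>\<^sub>F y in at x. norm (w y - a y) \<le> q y * (2 * norm (a y))"
      using evU evq
    proof eventually_elim
      case (elim y)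
      have "0 \<le> q y" unfolding q_def by (intro sum_nonneg) auto
      have "q y * norm (w y) \<le> 1/2 * norm (w y)" using elim by (intro mult_right_mono) auto
      then have "norm (w y - a y) \<le> 1/2 * norm (w y)"
        using wa[OF elim(1)] by (rule order_trans[rotated])
      moreover have "norm (w y) \<le> norm (w y - a y) + norm (a y)"
        using norm_triangle_ineq[of "w y - a y" "a y"] by simp
      ultimately have "norm (w y) \<le> 2 * norm (a y)" by simp
      then have "q y * norm (w y) \<le> q y * (2 * norm (a y))"
        using \<open>0 \<le> q y\<close> by (rule mult_left_mono)
      then show ?case using wa[OF elim(1)] by (rule order_trans[rotated])
    qed
    have "((\<lambda>y. q y * (2 * norm (a y))) \<longlongrightarrow> 0 * (2 * norm (a x))) (at x)"
      by (intro tendsto_intros cq ca)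
    then show "((\<lambda>y. q y * (2 * norm (a y))) \<longlongrightarrow> 0) (at x)" by simp
  qed
  have "isCont w x"
    using tendsto_add[OF lim_wa ca] wx by (simp add: isCont_def)
  then have "(\<lambda>y. p c d y * (w y \<bullet> d)) differentiable (at x)" for c d
    by (intro differentiable_mult_vanishing_left dp px isCont_inner) auto
  then have "W differentiable (at x)"
    unfolding W_def
    by (intro differentiable_sum ballI differentiable_scaleR differentiable_diff d\<alpha> differentiable_const) auto
  then obtain W' where "(W has_derivative W') (at x)" by (auto simp: differentiable_def)
  then have "(w has_derivative W') (at x)"
    by (rule has_derivative_transform_within_open[OF _ U]) (simp add: w_eq[symmetric])
  then show ?thesis by (auto simp: w_def[abs_def] differentiable_def)
qed

section \<open>Local metrics and their Christoffel symbols\<close>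

lemma smooth_on_differentiable:
  assumes "smooth_on F S" and "x \<in> S"
  shows "F differentiable (at x)"
proof -
  have "Ck_on (Suc 0) F S" using assms(1) unfolding smooth_on_def by blast
  then show ?thesis using assms(2) by simp
qed

lemma smooth_on_frechet_derivative:
  assumes "smooth_on F S"
  shows "smooth_on (\<lambda>x. frechet_derivative F (at x) u) S"
  unfolding smooth_on_def
proof
  fix k
  have "Ck_on (Suc k) F S" using assms unfolding smooth_on_def by blast
  then show "Ck_on k (\<lambda>x. frechet_derivative F (at x) u) S" by simp
qed

lemma smooth_on_has_derivative:
  "smooth_on F S \<Longrightarrow> x \<in> S \<Longrightarrow> (F has_derivative frechet_derivative F (at x)) (at x)"
  by (simp add: smooth_on_differentiable frechet_derivative_works[symmetric])

lemma smooth_on_linear_frechet_derivative: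
  "smooth_on F S \<Longrightarrow> x \<in> S \<Longrightarrow> linear (frechet_derivative F (at x))"
  by (simp add: smooth_on_differentiable linear_frechet_derivative)

lemma frechet_derivative_eqI: "(F has_derivative F') (at x) \<Longrightarrow> frechet_derivative F (at x) = F'"
  by (rule frechet_derivative_at[symmetric])

text \<open>The inner derivative is taken in the direction \<open>v\<close>, the outer one in the direction \<open>u\<close>. At a
  critical point this is the Hessian tensor of every metric, as the Christoffel
  correction is a combination of first derivatives.\<close>

definition second_derivative ::
  "('e::euclidean_space \<Rightarrow> real) \<Rightarrow> 'e \<Rightarrow> 'e \<Rightarrow> 'e \<Rightarrow> real" where
  "second_derivative F x u v = frechet_derivative (\<lambda>y. frechet_derivative F (at y) v) (at x) u"

definition metric_on ::
  "('e::euclidean_space \<Rightarrow> 'e \<Rightarrow> 'e \<Rightarrow> real) \<Rightarrow> 'e set \<Rightarrow> bool" where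
  "metric_on G U \<longleftrightarrow> open U \<and> (\<forall>x\<in>U. nondegenerate (G x)) \<and>
     (\<forall>u v. smooth_on (\<lambda>x. G x u v) U)"

lemma metric_onD:
  assumes "metric_on G U"
  shows "open U" and "x \<in> U \<Longrightarrow> nondegenerate (G x)" and "x \<in> U \<Longrightarrow> bilinear (G x)"
    and "smooth_on (\<lambda>x. G x u v) U"
  using assms by (auto simp: metric_on_def nondegenerate_def)

lemma metric_on_differentiable:
  "metric_on G U \<Longrightarrow> x \<in> U \<Longrightarrow> (\<lambda>y. G y u v) differentiable (at x)"
  by (rule smooth_on_differentiable[OF metric_onD(4)])

text \<open>Differentiation with respect to the point commutes with the linear operations in the
  remaining argument.\<close>

lemma linear_frechet_derivative_param:
  fixes \<alpha> :: "'e::euclidean_space \<Rightarrow> 'w::real_vector \<Rightarrow> real"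
  assumes U: "open U" "x \<in> U" and lin: "\<And>y. y \<in> U \<Longrightarrow> linear (\<alpha> y)"
    and d: "\<And>z. (\<lambda>y. \<alpha> y z) differentiable (at x)"
  shows "linear (\<lambda>z. frechet_derivative (\<lambda>y. \<alpha> y z) (at x) u)"
proof (rule linearI)
  have D: "((\<lambda>y. \<alpha> y z) has_derivative frechet_derivative (\<lambda>y. \<alpha> y z) (at x)) (at x)" for z
    using d by (simp add: frechet_derivative_works[symmetric])
  fix z z' c
  have "((\<lambda>y. \<alpha> y z + \<alpha> y z') has_derivative (\<lambda>u. frechet_derivative (\<lambda>y. \<alpha> y z) (at x) u
      + frechet_derivative (\<lambda>y. \<alpha> y z') (at x) u)) (at x)"
    by (intro has_derivative_add D)
  then have "((\<lambda>y. \<alpha> y (z + z')) has_derivative (\<lambda>u. frechet_derivative (\<lambda>y. \<alpha> y z) (at x) u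
      + frechet_derivative (\<lambda>y. \<alpha> y z') (at x) u)) (at x)"
    by (rule has_derivative_transform_within_open[OF _ U]) (simp add: lin linear_add)
  then show "frechet_derivative (\<lambda>y. \<alpha> y (z + z')) (at x) u
      = frechet_derivative (\<lambda>y. \<alpha> y z) (at x) u + frechet_derivative (\<lambda>y. \<alpha> y z') (at x) u"
    by (simp add: frechet_derivative_eqI)
  have "((\<lambda>y. c * \<alpha> y z) has_derivative (\<lambda>u. c * frechet_derivative (\<lambda>y. \<alpha> y z) (at x) u)) (at x)"
    by (intro has_derivative_mult_right D)
  then have "((\<lambda>y. \<alpha> y (c *\<^sub>R z)) has_derivative
      (\<lambda>u. c * frechet_derivative (\<lambda>y. \<alpha> y z) (at x) u)) (at x)"
    by (rule has_derivative_transform_within_open[OF _ U]) (simp add: lin linear_scale)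
  then show "frechet_derivative (\<lambda>y. \<alpha> y (c *\<^sub>R z)) (at x) u
      = c *\<^sub>R frechet_derivative (\<lambda>y. \<alpha> y z) (at x) u"
    by (simp add: frechet_derivative_eqI)
qed

lemma bilinear_second_derivative:
  assumes F: "smooth_on F U" and U: "open U" "x \<in> U"
  shows "bilinear (second_derivative F x)"
  unfolding bilinear_def second_derivative_def
proof (intro conjI allI)
  show "linear (\<lambda>v. frechet_derivative (\<lambda>y. frechet_derivative F (at y) v) (at x) u)" for u
    by (rule linear_frechet_derivative_param[OF U smooth_on_linear_frechet_derivative[OF F]
          smooth_on_differentiable[OF smooth_on_frechet_derivative[OF F] U(2)]])
  show "linear (frechet_derivative (\<lambda>y. frechet_derivative F (at y) v) (at x))" for v
    by (rule smooth_on_linear_frechet_derivative[OF smooth_on_frechet_derivative[OF F] U(2)])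
qed

text \<open>The Christoffel symbols of the first kind, with the last index lowered.\<close>

definition christoffel_form ::
  "('e::euclidean_space \<Rightarrow> 'e \<Rightarrow> 'e \<Rightarrow> real) \<Rightarrow> 'e \<Rightarrow> 'e \<Rightarrow> 'e \<Rightarrow> 'e \<Rightarrow> real" where
  "christoffel_form G x u v z =
     (frechet_derivative (\<lambda>y. G y v z) (at x) u
      + frechet_derivative (\<lambda>y. G y u z) (at x) v
      - frechet_derivative (\<lambda>y. G y u v) (at x) z) / 2"

lemma christoffel_eq_sharp: "christoffel G x u v = sharp (G x) (christoffel_form G x u v)"
  by (simp add: christoffel_def christoffel_form_def[abs_def])

lemma linear_christoffel_form:
  assumes G: "metric_on G U" and x: "x \<in> U"
  shows "linear (christoffel_form G x u v)"
proof -
  note U = metric_onD(1)[OF G] x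
  have 1: "linear (\<lambda>z. frechet_derivative (\<lambda>y. G y v z) (at x) u)" for u v
    by (rule linear_frechet_derivative_param[OF U])
      (use metric_onD(3)[OF G] metric_on_differentiable[OF G x] in \<open>auto simp: bilinear_def\<close>)
  have 2: "linear (frechet_derivative (\<lambda>y. G y u v) (at x))"
    using smooth_on_linear_frechet_derivative metric_onD(4)[OF G] x by blast
  have "linear (\<lambda>z. (1/2) *\<^sub>R (frechet_derivative (\<lambda>y. G y v z) (at x) u
      + frechet_derivative (\<lambda>y. G y u z) (at x) v
      - frechet_derivative (\<lambda>y. G y u v) (at x) z))"
    by (intro linear_compose_scale_right linear_compose_sub linear_compose_add 1 2)
  then show ?thesis by (simp add: christoffel_form_def[abs_def])
qed

lemma metric_christoffel:
  assumes "metric_on G U" and "x \<in> U"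
  shows "G x (christoffel G x u v) z = christoffel_form G x u v z"
  unfolding christoffel_eq_sharp
  by (intro sharp_works metric_onD(2)[OF assms] linear_christoffel_form[OF assms])

lemma differentiable_christoffel:
  assumes G: "metric_on G U" and x: "x \<in> U"
  shows "(\<lambda>y. christoffel G y u v) differentiable (at x)"
  unfolding christoffel_eq_sharp
proof (rule differentiable_sharp[OF metric_onD(1)[OF G] x])
  show "(\<lambda>y. christoffel_form G y u v z) differentiable (at x)" for z
    unfolding christoffel_form_def divide_inverse
    by (intro differentiable_mult differentiable_diff differentiable_add differentiable_const
        smooth_on_differentiable[OF _ x] smooth_on_frechet_derivative metric_onD(4)[OF G])
qed (use metric_onD(2)[OF G] metric_on_differentiable[OF G x] linear_christoffel_form[OF G] in auto)

lemma frechet_derivative_vanishing: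
  assumes U: "open U" "x \<in> U" and "\<And>y. y \<in> U \<Longrightarrow> F y = 0"
  shows "frechet_derivative F (at x) = (\<lambda>u. 0)"
  by (intro frechet_derivative_eqI has_derivative_transform_within_open[OF has_derivative_const U])
    (simp add: assms(3))

lemma christoffel_zero:
  assumes G: "metric_on G U" and x: "x \<in> U"
  shows "christoffel G x u 0 = 0" and "christoffel G x 0 v = 0"
proof -
  note van = frechet_derivative_vanishing[OF metric_onD(1)[OF G] x]
  have "frechet_derivative (\<lambda>y. G y 0 z) (at x) = (\<lambda>u. 0)"
    and "frechet_derivative (\<lambda>y. G y z 0) (at x) = (\<lambda>u. 0)" for z
    by (rule van, use metric_onD(3)[OF G] in \<open>simp add: bilinear_lzero bilinear_rzero\<close>)+
  moreover have "linear (frechet_derivative (\<lambda>y. G y u v) (at x))" for u v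
    using smooth_on_linear_frechet_derivative metric_onD(4)[OF G] x by blast
  ultimately have "christoffel_form G x u 0 = (\<lambda>z. 0)" and "christoffel_form G x 0 v = (\<lambda>z. 0)"
    by (auto simp: christoffel_form_def fun_eq_iff linear_0)
  then show "christoffel G x u 0 = 0" and "christoffel G x 0 v = 0"
    using sharp_zero metric_onD(2)[OF G x] by (auto simp: christoffel_eq_sharp)
qed

lemma local_ricci_zero:
  assumes G: "metric_on G U" and x: "x \<in> U"
  shows "local_ricci G x 0 0 = 0"
proof -
  have "frechet_derivative (\<lambda>y. christoffel G y z 0) (at x) = (\<lambda>u. 0)"
    and "frechet_derivative (\<lambda>y. christoffel G y 0 z) (at x) = (\<lambda>u. 0)" for z
    by (rule frechet_derivative_vanishing[OF metric_onD(1)[OF G] x], simp add: christoffel_zero[OF G])+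
  then show ?thesis by (simp add: local_ricci_def riemann_def christoffel_zero[OF G x])
qed

section \<open>Warped products in coordinates\<close>

lemma has_derivative_comp_fst:
  assumes "(F has_derivative F') (at x)"
  shows "((\<lambda>q. F (fst q)) has_derivative (\<lambda>z. F' (fst z))) (at (x, y))"
proof -
  have "(fst has_derivative fst) (at (x, y))"
    by (simp add: bounded_linear_imp_has_derivative bounded_linear_fst)
  from has_derivative_compose[OF this, of F F'] show ?thesis by (simp add: assms)
qed

lemma has_derivative_comp_snd:
  assumes "(F has_derivative F') (at y)"
  shows "((\<lambda>q. F (snd q)) has_derivative (\<lambda>z. F' (snd z))) (at (x, y))"
proof -
  have "(snd has_derivative snd) (at (x, y))"
    by (simp add: bounded_linear_imp_has_derivative bounded_linear_snd)
  from has_derivative_compose[OF this, of F F'] show ?thesis by (simp add: assms)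
qed

text \<open>Where the vector field \<open>w\<close> vanishes, the derivative of the metric drops out of the product
  rule. This is the reason why covariant and coordinate derivatives of a gradient agree
  at a critical point.\<close>

lemma has_derivative_metric_vanishing_vector:
  fixes G :: "'e::euclidean_space \<Rightarrow> 'e \<Rightarrow> 'e \<Rightarrow> real"
  assumes G: "metric_on G U" and x: "x \<in> U"
    and w: "(w has_derivative w') (at x)" and "w x = 0"
  shows "((\<lambda>y. G y (w y) v) has_derivative (\<lambda>z. G x (w' z) v)) (at x)"
proof -
  note U = metric_onD(1)[OF G] x
  have expand: "G y u v = (\<Sum>b\<in>Basis. (u \<bullet> b) * G y b v)" if "y \<in> U" for y u
    using linear_eq_sum_Basis[OF linear_bilinear_left[OF metric_onD(3)[OF G that]], of u v] by simp
  have "((\<lambda>y. \<Sum>b\<in>Basis. (w y \<bullet> b) * G y b v) has_derivative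
      (\<lambda>z. \<Sum>b\<in>Basis. (w x \<bullet> b) * frechet_derivative (\<lambda>y. G y b v) (at x) z
        + (w' z \<bullet> b) * G x b v)) (at x)"
    by (intro has_derivative_sum has_derivative_mult has_derivative_inner_left w
        smooth_on_has_derivative[OF metric_onD(4)[OF G] x])
  then have "((\<lambda>y. \<Sum>b\<in>Basis. (w y \<bullet> b) * G y b v) has_derivative (\<lambda>z. G x (w' z) v)) (at x)"
    by (simp add: \<open>w x = 0\<close> expand[OF x, symmetric])
  then show ?thesis
    by (rule has_derivative_transform_within_open[OF _ U]) (simp add: expand[symmetric])
qed

lemma sum_Basis_prod:
  fixes s :: "'e::euclidean_space \<times> 'd::euclidean_space \<Rightarrow> 'c::comm_monoid_add"
  shows "sum s Basis = (\<Sum>b\<in>Basis. s (b, 0)) + (\<Sum>b\<in>Basis. s (0, b))"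
proof -
  have inj: "inj_on (\<lambda>u. (u::'e, 0::'d)) Basis" "inj_on (\<lambda>u. (0::'e, u::'d)) Basis"
    by (auto intro!: inj_onI)
  have "sum s Basis = sum s ((\<lambda>u. (u, 0)) ` Basis) + sum s ((\<lambda>u. (0, u)) ` Basis)"
    unfolding Basis_prod_def by (rule sum.union_disjoint) auto
  then show ?thesis by (simp add: sum.reindex[OF inj(1)] sum.reindex[OF inj(2)])
qed

text \<open>The coordinate expression \<open>K\<close> of a warped product over a pair of charts, with base metric \<open>G\<close>,
  fiber metric \<open>H\<close> and warping function \<open>F\<close>. Nothing is known about \<open>K\<close> off the product of the
  chart images, so derivatives of its Christoffel symbols have to be computed by passing to
  an explicit expression that agrees with them on this open set.\<close>

locale local_warped_product =
  fixes G :: "'e::euclidean_space \<Rightarrow> 'e \<Rightarrow> 'e \<Rightarrow> real" and U :: "'e set"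
    and H :: "'d::euclidean_space \<Rightarrow> 'd \<Rightarrow> 'd \<Rightarrow> real" and V :: "'d set"
    and F :: "'e \<Rightarrow> real"
    and K :: "'e \<times> 'd \<Rightarrow> 'e \<times> 'd \<Rightarrow> 'e \<times> 'd \<Rightarrow> real"
  assumes G: "metric_on G U" and H: "metric_on H V"
    and F: "smooth_on F U" and F_pos: "x \<in> U \<Longrightarrow> F x > 0"
    and K: "x \<in> U \<Longrightarrow> y \<in> V \<Longrightarrow>
      K (x, y) (u, u') (v, v') = G x u v + (F x)\<^sup>2 * H y u' v'"
begin

abbreviation dF :: "'e \<Rightarrow> 'e \<Rightarrow> real" where
  "dF x \<equiv> frechet_derivative F (at x)"

definition grad :: "'e \<Rightarrow> 'e" where
  "grad x = sharp (G x) (dF x)"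

lemma metric_grad: "x \<in> U \<Longrightarrow> G x (grad x) z = dF x z"
  unfolding grad_def
  by (rule sharp_works[OF metric_onD(2)[OF G] smooth_on_linear_frechet_derivative[OF F]])

lemma nondegenerate_K:
  assumes x: "x \<in> U" and y: "y \<in> V"
  shows "nondegenerate (K (x, y))"
  unfolding nondegenerate_def
proof (intro conjI allI impI)
  have bG: "bilinear (G x)" and bH: "bilinear (H y)"
    using metric_onD(3)[OF G x] metric_onD(3)[OF H y] by auto
  have eq: "K (x, y) p q = G x (fst p) (fst q) + (F x)\<^sup>2 * H y (snd p) (snd q)" for p q
    using K[OF x y, of "fst p" "snd p" "fst q" "snd q"] by simp
  have "linear (\<lambda>q. K (x, y) p q)" for p
    by (rule linearI)
      (simp_all add: eq bilinear_radd[OF bG] bilinear_rmul[OF bG] bilinear_radd[OF bH]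
        bilinear_rmul[OF bH] distrib_left mult.left_commute)
  moreover have "linear (\<lambda>p. K (x, y) p q)" for q
    by (rule linearI)
      (simp_all add: eq bilinear_ladd[OF bG] bilinear_lmul[OF bG] bilinear_ladd[OF bH]
        bilinear_lmul[OF bH] distrib_left mult.left_commute)
  ultimately show "bilinear (K (x, y))" unfolding bilinear_def by blast
  fix w assume *: "\<forall>v. K (x, y) w v = 0"
  obtain u u' where w: "w = (u, u')" by force
  have "G x u v = 0" for v
    using *[rule_format, of "(v, 0)"] by (simp add: w K[OF x y] bilinear_rzero[OF bH])
  then have "u = 0" using metric_onD(2)[OF G x] by (simp add: nondegenerate_def)
  have "H y u' v' = 0" for v'
    using *[rule_format, of "(0, v')"] F_pos[OF x] by (simp add: w K[OF x y] bilinear_rzero[OF bG])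
  then have "u' = 0" using metric_onD(2)[OF H y] by (simp add: nondegenerate_def)
  show "w = 0" by (simp add: w \<open>u = 0\<close> \<open>u' = 0\<close> zero_prod_def)
qed

lemma open_UV: "open (U \<times> V)"
  by (intro open_Times metric_onD(1)[OF G] metric_onD(1)[OF H])

lemma frechet_derivative_K:
  assumes x: "x \<in> U" and y: "y \<in> V"
  shows "frechet_derivative (\<lambda>q. K q (u, u') (v, v')) (at (x, y)) (z, z') =
    frechet_derivative (\<lambda>q. G q u v) (at x) z + 2 * F x * dF x z * H y u' v'
    + (F x)\<^sup>2 * frechet_derivative (\<lambda>q. H q u' v') (at y) z'"
proof -
  note dG = smooth_on_has_derivative[OF metric_onD(4)[OF G] x]
    and dH = smooth_on_has_derivative[OF metric_onD(4)[OF H] y]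
    and dF = smooth_on_has_derivative[OF F x]
  have "((\<lambda>q. G (fst q) u v + (F (fst q))\<^sup>2 * H (snd q) u' v') has_derivative
      (\<lambda>z. frechet_derivative (\<lambda>q. G q u v) (at x) (fst z)
        + ((F (fst (x, y)))\<^sup>2 * frechet_derivative (\<lambda>q. H q u' v') (at y) (snd z)
          + (of_nat 2 * dF x (fst z) * F (fst (x, y)) ^ (2 - 1)) * H (snd (x, y)) u' v'))) (at (x, y))"
    by (intro has_derivative_add has_derivative_mult has_derivative_power
        has_derivative_comp_fst[OF dG] has_derivative_comp_fst[OF dF] has_derivative_comp_snd[OF dH])
  then have "((\<lambda>q. K q (u, u') (v, v')) has_derivative
      (\<lambda>z. frechet_derivative (\<lambda>q. G q u v) (at x) (fst z)
        + ((F (fst (x, y)))\<^sup>2 * frechet_derivative (\<lambda>q. H q u' v') (at y) (snd z)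
          + (of_nat 2 * dF x (fst z) * F (fst (x, y)) ^ (2 - 1)) * H (snd (x, y)) u' v'))) (at (x, y))"
    by (rule has_derivative_transform_within_open[OF _ open_UV]) (use x y K in auto)
  from frechet_derivative_eqI[OF this] show ?thesis by simp
qed

text \<open>The connection of a warped product. It is found by solving for the vector that represents the
  Christoffel symbols of the first kind, which decouple into a base and a fiber part.\<close>

lemma christoffel_K:
  assumes x: "x \<in> U" and y: "y \<in> V"
  shows "christoffel K (x, y) (u, u') (v, v') =
    (christoffel G x u v - (F x * H y u' v') *\<^sub>R grad x,
     christoffel H y u' v' + (dF x u / F x) *\<^sub>R v' + (dF x v / F x) *\<^sub>R u')"
  unfolding christoffel_eq_sharp[of K]
proof (rule sharp_eqI[OF nondegenerate_K[OF x y]])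
  fix w :: "'e \<times> 'd"
  obtain z z' where w: "w = (z, z')" by force
  have bG: "bilinear (G x)" and bH: "bilinear (H y)"
    using metric_onD(3)[OF G x] metric_onD(3)[OF H y] by auto
  have F0: "F x \<noteq> 0" using F_pos[OF x] by simp
  have "G x (christoffel G x u v - (F x * H y u' v') *\<^sub>R grad x) z
      = christoffel_form G x u v z - F x * H y u' v' * dF x z"
    by (simp add: bilinear_lsub[OF bG] bilinear_lmul[OF bG] metric_christoffel[OF G x] metric_grad[OF x])
  moreover have "(F x)\<^sup>2 * H y (christoffel H y u' v' + (dF x u / F x) *\<^sub>R v' + (dF x v / F x) *\<^sub>R u') z'
      = (F x)\<^sup>2 * christoffel_form H y u' v' z' + F x * dF x u * H y v' z' + F x * dF x v * H y u' z'"
    using F0 by (simp add: bilinear_ladd[OF bH] bilinear_lmul[OF bH] metric_christoffel[OF H y]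
        distrib_left power2_eq_square)
  moreover have "christoffel_form K (x, y) (u, u') (v, v') (z, z')
      = christoffel_form G x u v z + (F x)\<^sup>2 * christoffel_form H y u' v' z'
        + F x * (dF x u * H y v' z' + dF x v * H y u' z' - dF x z * H y u' v')"
    unfolding christoffel_form_def frechet_derivative_K[OF x y]
    by (simp add: add_divide_distrib diff_divide_distrib algebra_simps)
  ultimately show "K (x, y) (christoffel G x u v - (F x * H y u' v') *\<^sub>R grad x,
     christoffel H y u' v' + (dF x u / F x) *\<^sub>R v' + (dF x v / F x) *\<^sub>R u') w
     = christoffel_form K (x, y) (u, u') (v, v') w"
    unfolding w K[OF x y] by (simp add: algebra_simps)
qed

text \<open>Differentiating the defining equation of the gradient at a zero of the gradient shows that its
  derivative is the Hessian with an index raised.\<close>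

lemma grad_has_derivative_critical:
  assumes x: "x \<in> U" and crit: "dF x = (\<lambda>z. 0)"
  shows "(grad has_derivative (\<lambda>z. sharp (G x) (second_derivative F x z))) (at x)"
proof -
  have "grad differentiable (at x)"
    unfolding grad_def[abs_def]
    by (rule differentiable_sharp[OF metric_onD(1)[OF G] x])
      (use metric_onD(2)[OF G] metric_on_differentiable[OF G x] smooth_on_linear_frechet_derivative[OF F]
        smooth_on_differentiable[OF smooth_on_frechet_derivative[OF F] x] in auto)
  then obtain A where A: "(grad has_derivative A) (at x)" by (auto simp: differentiable_def)
  have grad0: "grad x = 0"
    unfolding grad_def crit by (rule sharp_zero[OF metric_onD(2)[OF G x]])
  have "G x (A z) w = second_derivative F x z w" for z w
  proof -
    have "((\<lambda>y. G y (grad y) w) has_derivative (\<lambda>z. G x (A z) w)) (at x)"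
      by (rule has_derivative_metric_vanishing_vector[OF G x A grad0])
    then have "((\<lambda>y. dF y w) has_derivative (\<lambda>z. G x (A z) w)) (at x)"
      by (rule has_derivative_transform_within_open[OF _ metric_onD(1)[OF G] x]) (rule metric_grad)
    then show ?thesis by (simp add: second_derivative_def frechet_derivative_eqI)
  qed
  then have "A = (\<lambda>z. sharp (G x) (second_derivative F x z))"
    by (intro ext sharp_eqI[OF metric_onD(2)[OF G x], symmetric])
  then show ?thesis using A by simp
qed

text \<open>At a critical point of the warping function the mixed terms of the connection vanish, but their
  derivatives do not: these contribute exactly the Hessian terms of the curvature.\<close>

context
  fixes x :: 'e and y :: 'd
  assumes x: "x \<in> U" and y: "y \<in> V" and crit: "dF x = (\<lambda>z. 0)"
begin

lemma christoffel_K_critical: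
  "christoffel K (x, y) (u, u') (v, v') = (christoffel G x u v, christoffel H y u' v')"
  unfolding christoffel_K[OF x y] crit grad_def sharp_zero[OF metric_onD(2)[OF G x]] by simp

lemma frechet_derivative_christoffel_K_critical:
  "frechet_derivative (\<lambda>q. christoffel K q (u, u') (v, v')) (at (x, y)) (z, z') =
    (frechet_derivative (\<lambda>q. christoffel G q u v) (at x) z
       - (F x * H y u' v') *\<^sub>R sharp (G x) (second_derivative F x z),
     frechet_derivative (\<lambda>q. christoffel H q u' v') (at y) z'
       + (second_derivative F x z u / F x) *\<^sub>R v' + (second_derivative F x z v / F x) *\<^sub>R u')"
proof -
  have F0: "F x \<noteq> 0" using F_pos[OF x] by simp
  have grad0: "grad x = 0"
    unfolding grad_def crit by (rule sharp_zero[OF metric_onD(2)[OF G x]])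
  have dGam: "((\<lambda>q. christoffel G q u v) has_derivative
      frechet_derivative (\<lambda>q. christoffel G q u v) (at x)) (at x)"
    using differentiable_christoffel[OF G x] by (simp add: frechet_derivative_works[symmetric])
  have dGam': "((\<lambda>q. christoffel H q u' v') has_derivative
      frechet_derivative (\<lambda>q. christoffel H q u' v') (at y)) (at y)"
    using differentiable_christoffel[OF H y] by (simp add: frechet_derivative_works[symmetric])
  note dH = smooth_on_has_derivative[OF metric_onD(4)[OF H, of u' v'] y]
    and dF = smooth_on_has_derivative[OF F x]
  have ddF: "((\<lambda>q. dF q w) has_derivative (\<lambda>z. second_derivative F x z w)) (at x)" for w
    unfolding second_derivative_def
    by (rule smooth_on_has_derivative[OF smooth_on_frechet_derivative[OF F] x])
  have quot: "((\<lambda>q. dF q w / F q) has_derivative (\<lambda>z. second_derivative F x z w / F x)) (at x)" for w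
  proof -
    have "((\<lambda>q. dF q w / F q) has_derivative
        (\<lambda>z. (second_derivative F x z w * F x - dF x w * dF x z) / (F x * F x))) (at x)"
      by (rule has_derivative_divide'[OF ddF dF F0])
    then show ?thesis using F0 by (simp add: crit)
  qed
  have FH: "((\<lambda>q. F (fst q) * H (snd q) u' v') has_derivative
     (\<lambda>z. F (fst (x, y)) * frechet_derivative (\<lambda>q. H q u' v') (at y) (snd z)
        + dF x (fst z) * H (snd (x, y)) u' v')) (at (x, y))"
    by (intro has_derivative_mult has_derivative_comp_fst[OF dF] has_derivative_comp_snd[OF dH])
  have "((\<lambda>q. (F (fst q) * H (snd q) u' v') *\<^sub>R grad (fst q)) has_derivative
      (\<lambda>z. (F x * H y u' v') *\<^sub>R sharp (G x) (second_derivative F x (fst z)))) (at (x, y))"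
    using has_derivative_scaleR[OF FH has_derivative_comp_fst[OF grad_has_derivative_critical[OF x crit]]]
    by (simp add: grad0)
  then have "((\<lambda>q. (christoffel G (fst q) u v - (F (fst q) * H (snd q) u' v') *\<^sub>R grad (fst q),
        christoffel H (snd q) u' v' + (dF (fst q) u / F (fst q)) *\<^sub>R v'
          + (dF (fst q) v / F (fst q)) *\<^sub>R u'))
      has_derivative (\<lambda>z. (frechet_derivative (\<lambda>q. christoffel G q u v) (at x) (fst z)
       - (F x * H y u' v') *\<^sub>R sharp (G x) (second_derivative F x (fst z)),
       frechet_derivative (\<lambda>q. christoffel H q u' v') (at y) (snd z)
         + (second_derivative F x (fst z) u / F x) *\<^sub>R v'
         + (second_derivative F x (fst z) v / F x) *\<^sub>R u'))) (at (x, y))"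
    by (intro has_derivative_Pair has_derivative_diff has_derivative_add has_derivative_scaleR_left
        has_derivative_comp_fst[OF dGam] has_derivative_comp_snd[OF dGam']
        has_derivative_comp_fst[OF quot])
  then have "((\<lambda>q. christoffel K q (u, u') (v, v')) has_derivative
       (\<lambda>z. (frechet_derivative (\<lambda>q. christoffel G q u v) (at x) (fst z)
       - (F x * H y u' v') *\<^sub>R sharp (G x) (second_derivative F x (fst z)),
       frechet_derivative (\<lambda>q. christoffel H q u' v') (at y) (snd z)
         + (second_derivative F x (fst z) u / F x) *\<^sub>R v'
         + (second_derivative F x (fst z) v / F x) *\<^sub>R u'))) (at (x, y))"
    by (rule has_derivative_transform_within_open[OF _ open_UV]) (use x y christoffel_K in auto)
  from frechet_derivative_eqI[OF this] show ?thesis by simp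
qed

text \<open>The warped product formula for the Ricci tensor at a critical point. In the trace, the horizontal
  directions contribute the Laplacian times the fiber metric, while each of the vertical
  directions contributes the same multiple of the Hessian.\<close>

lemma local_ricci_K_critical:
  "local_ricci K (x, y) (u, u') (v, v') =
    local_ricci G x u v - real DIM('d) / F x * second_derivative F x u v
    + local_ricci H y u' v'
    - F x * metric_trace (G x) (second_derivative F x) * H y u' v'"
proof -
  have bH: "bilinear (H y)" using metric_onD(3)[OF H y] .
  have bF: "bilinear (second_derivative F x)"
    by (rule bilinear_second_derivative[OF F metric_onD(1)[OF G] x])
  have horizontal: "riemann K (x, y) (b, 0) (u, u') (v, v') \<bullet> (b, 0)
      = riemann G x b u v \<bullet> b - F x * H y u' v' * (sharp (G x) (second_derivative F x b) \<bullet> b)" for b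
    by (simp add: riemann_def frechet_derivative_christoffel_K_critical christoffel_K_critical
        bilinear_lzero[OF bH] inner_diff_left inner_add_left)
  have vertical: "riemann K (x, y) (0, b) (u, u') (v, v') \<bullet> (0, b)
      = riemann H y b u' v' \<bullet> b - second_derivative F x u v / F x" if "b \<in> Basis" for b
    using that
    by (simp add: riemann_def frechet_derivative_christoffel_K_critical christoffel_K_critical
        bilinear_lzero[OF bF] bilinear_rzero[OF bF] inner_diff_left inner_add_left)
  show ?thesis
    unfolding local_ricci_def metric_trace_def sum_Basis_prod
    by (simp add: horizontal vertical sum_subtractf sum_distrib_left sum_distrib_right mult_ac)
qed

end

end

section \<open>Second order conditions at an extremum\<close>

text \<open>Gram--Schmidt for a positive definite form other than the inner product of the ambient
  space. Orthonormality is expressed by the reproducing formula, which is all that traces need.\<close>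

lemma orthonormal_frame_span:
  fixes B :: "'e::euclidean_space \<Rightarrow> 'e \<Rightarrow> real"
  assumes bil: "bilinear B" and sym: "\<And>u v. B u v = B v u" and pos: "\<And>u. u \<noteq> 0 \<Longrightarrow> B u u > 0"
    and "finite S"
  shows "\<exists>E. finite E \<and> E \<subseteq> span S \<and> (\<forall>v\<in>span S. v = (\<Sum>e\<in>E. B v e *\<^sub>R e))"
  using \<open>finite S\<close>
proof (induction S)
  case empty
  show ?case by (rule exI[of _ "{}"]) simp
next
  case (insert a S)
  then obtain E where E: "finite E" "E \<subseteq> span S"
    and rep: "\<And>v. v \<in> span S \<Longrightarrow> v = (\<Sum>e\<in>E. B v e *\<^sub>R e)" by blast
  define p where "p = (\<Sum>e\<in>E. B a e *\<^sub>R e)"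
  define r where "r = a - p"
  have p: "p \<in> span S" unfolding p_def using E by (auto intro!: span_sum span_scale)
  have orth: "B r w = 0" if "w \<in> span S" for w
  proof -
    have "B a w = B a (\<Sum>e\<in>E. B w e *\<^sub>R e)" using rep[OF that] by simp
    also have "\<dots> = (\<Sum>e\<in>E. B w e * B a e)"
      by (simp add: linear_sum[OF linear_bilinear_right[OF bil]] bilinear_rmul[OF bil])
    also have "\<dots> = (\<Sum>e\<in>E. B a e * B e w)" by (simp add: sym[of w] mult.commute)
    also have "\<dots> = B p w"
      unfolding p_def by (simp add: linear_sum[OF linear_bilinear_left[OF bil]] bilinear_lmul[OF bil])
    finally show ?thesis by (simp add: r_def bilinear_lsub[OF bil])
  qed
  show ?case
  proof (cases "r = 0")
    case True
    then have "a \<in> span S" using p by (simp add: r_def)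
    then show ?thesis using E rep by (auto simp: span_redundant)
  next
    case False
    define c where "c = sqrt (B r r)"
    have c: "c > 0" "B r r = c * c" using pos[OF False] by (auto simp: c_def)
    define e0 where "e0 = r /\<^sub>R c"
    have "e0 \<notin> E"
    proof
      assume "e0 \<in> E"
      then have "B r e0 = 0" using orth E by blast
      then show False using c by (simp add: e0_def bilinear_rmul[OF bil])
    qed
    have mono: "span S \<subseteq> span (insert a S)" by (intro span_mono) auto
    have "r \<in> span (insert a S)"
      unfolding r_def using p mono by (intro span_diff) (auto intro: span_base)
    then have sub: "insert e0 E \<subseteq> span (insert a S)"
      using E mono by (auto simp: e0_def intro: span_scale)
    have "v = (\<Sum>e\<in>insert e0 E. B v e *\<^sub>R e)" if v: "v \<in> span (insert a S)" for v
    proof -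
      obtain k where k: "v - k *\<^sub>R a \<in> span S" using v span_breakdown_eq by blast
      define s where "s = (v - k *\<^sub>R a) + k *\<^sub>R p"
      have s: "s \<in> span S" unfolding s_def by (intro span_add span_scale k p)
      have vs: "v = k *\<^sub>R r + s" by (simp add: s_def r_def algebra_simps)
      have "B v e0 *\<^sub>R e0 = k *\<^sub>R r"
        using c sym[of s r] orth[OF s]
        by (simp add: vs e0_def bilinear_ladd[OF bil] bilinear_lmul[OF bil] bilinear_rmul[OF bil])
      moreover have "(\<Sum>e\<in>E. B v e *\<^sub>R e) = (\<Sum>e\<in>E. B s e *\<^sub>R e)"
        using E orth by (intro sum.cong) (auto simp: vs bilinear_ladd[OF bil] bilinear_lmul[OF bil])
      ultimately show ?thesis using rep[OF s] \<open>e0 \<notin> E\<close> E(1) vs by simp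
    qed
    then show ?thesis using sub E(1) by (intro exI[of _ "insert e0 E"]) auto
  qed
qed

text \<open>The trace may be computed in a frame orthonormal for \<open>B\<close>: expand the vector with raised index in
  the frame, then recombine the Euclidean basis into the frame vectors.\<close>

lemma metric_trace_orthonormal_frame:
  fixes B :: "'e::euclidean_space \<Rightarrow> 'e \<Rightarrow> real"
  assumes B: "nondegenerate B" and T: "bilinear T" and E: "finite E"
    and frame: "\<And>v. v = (\<Sum>e\<in>E. B v e *\<^sub>R e)"
  shows "metric_trace B T = (\<Sum>e\<in>E. T e e)"
proof -
  have "sharp B (T b) \<bullet> b = (\<Sum>e\<in>E. (e \<bullet> b) * T b e)" for b
    by (subst frame[of "sharp B (T b)"])
      (simp add: inner_sum_left sharp_works[OF B linear_bilinear_right[OF T]] mult.commute)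
  then have "metric_trace B T = (\<Sum>e\<in>E. \<Sum>b\<in>Basis. (e \<bullet> b) * T b e)"
    unfolding metric_trace_def by (simp add: sum.swap[of _ E])
  also have "\<dots> = (\<Sum>e\<in>E. T e e)"
  proof (rule sum.cong[OF refl])
    fix e
    show "(\<Sum>b\<in>Basis. (e \<bullet> b) * T b e) = T e e"
      using linear_eq_sum_Basis[OF linear_bilinear_left[OF T], of e e] by simp
  qed
  finally show ?thesis .
qed

text \<open>The factor \<open>\<sigma>\<close>, here and below, stands for a sign, so that minima (\<open>\<sigma> = 1\<close>) and maxima
  (\<open>\<sigma> = -1\<close>) are treated at once.\<close>

lemma metric_trace_nonneg:
  fixes B :: "'e::euclidean_space \<Rightarrow> 'e \<Rightarrow> real"
  assumes B: "bilinear B" and sym: "\<And>u v. B u v = B v u" and pos: "\<And>u. u \<noteq> 0 \<Longrightarrow> B u u > 0"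
    and T: "bilinear T" and T_nonneg: "\<And>u. \<sigma> * T u u \<ge> 0"
  shows "\<sigma> * metric_trace B T \<ge> 0"
proof -
  have "nondegenerate B" unfolding nondegenerate_def using B pos by force
  moreover obtain E where "finite E" "\<And>v. v = (\<Sum>e\<in>E. B v e *\<^sub>R e)"
    using orthonormal_frame_span[OF B sym pos finite_Basis] by (auto simp: span_Basis)
  ultimately have "metric_trace B T = (\<Sum>e\<in>E. T e e)"
    using T by (intro metric_trace_orthonormal_frame) auto
  then show ?thesis by (simp add: sum_distrib_left sum_nonneg T_nonneg)
qed

lemma derivative_zero_at_extremum:
  fixes F :: "'e::euclidean_space \<Rightarrow> real"
  assumes F: "smooth_on F U" and U: "open U" "x \<in> U"
    and "\<sigma> \<noteq> 0" and min: "\<And>y. y \<in> U \<Longrightarrow> \<sigma> * F x \<le> \<sigma> * F y"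
  shows "frechet_derivative F (at x) = (\<lambda>z. 0)"
proof -
  have "((\<lambda>y. \<sigma> * F y) has_derivative (\<lambda>z. \<sigma> * frechet_derivative F (at x) z)) (at x)"
    by (intro has_derivative_mult_right smooth_on_has_derivative[OF F U(2)])
  moreover have "\<forall>\<^sub>F y in at x. \<sigma> * F x \<le> \<sigma> * F y"
    unfolding eventually_at_topological using U min by blast
  ultimately have "(\<lambda>z. \<sigma> * frechet_derivative F (at x) z) = (\<lambda>z. 0)"
    by (rule has_derivative_local_min)
  then show ?thesis using \<open>\<sigma> \<noteq> 0\<close> by (simp add: fun_eq_iff)
qed

text \<open>Otherwise the derivative along a line through \<open>x\<close>, which is zero at \<open>x\<close>, would be negative just
  after it, and the function would decrease.\<close>

lemma second_derivative_at_extremum: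
  fixes F :: "'e::euclidean_space \<Rightarrow> real"
  assumes F: "smooth_on F U" and U: "open U" "x \<in> U"
    and "\<sigma> \<noteq> 0" and min: "\<And>y. y \<in> U \<Longrightarrow> \<sigma> * F x \<le> \<sigma> * F y"
  shows "\<sigma> * second_derivative F x z z \<ge> 0"
proof (rule ccontr)
  assume neg: "\<not> ?thesis"
  have crit: "frechet_derivative F (at x) = (\<lambda>z. 0)"
    using derivative_zero_at_extremum[OF F U \<open>\<sigma> \<noteq> 0\<close> min] .
  define c where "c t = x + t *\<^sub>R z" for t :: real
  have dc: "(c has_derivative (\<lambda>s. s *\<^sub>R z)) (at t)" for t
    unfolding c_def by (auto intro!: derivative_eq_intros)
  have along: "((\<lambda>t. \<sigma> * P (c t)) has_real_derivative \<sigma> * frechet_derivative P (at (c t)) z) (at t)"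
    if "smooth_on P U" "c t \<in> U" for P :: "'e \<Rightarrow> real" and t
  proof -
    have "((\<lambda>t. P (c t)) has_derivative (\<lambda>s. frechet_derivative P (at (c t)) (s *\<^sub>R z))) (at t)"
      by (rule has_derivative_compose[OF dc smooth_on_has_derivative[OF that]])
    moreover have "(\<lambda>s. frechet_derivative P (at (c t)) (s *\<^sub>R z))
        = (\<lambda>s. frechet_derivative P (at (c t)) z * s)"
      using linear_scale[OF smooth_on_linear_frechet_derivative[OF that]] by (auto simp: mult.commute)
    ultimately have "((\<lambda>t. P (c t)) has_real_derivative frechet_derivative P (at (c t)) z) (at t)"
      by (simp add: has_field_derivative_def)
    then show ?thesis by (rule DERIV_cmult)
  qed
  have c0: "c 0 = x" by (simp add: c_def)
  define \<psi> where "\<psi> t = \<sigma> * frechet_derivative F (at (c t)) z" for t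
  have "(\<psi> has_real_derivative \<sigma> * second_derivative F x z z) (at 0)"
    unfolding \<psi>_def[abs_def] second_derivative_def
    using along[OF smooth_on_frechet_derivative[OF F], of 0 z] U c0 by simp
  then obtain d where d: "d > 0" "\<And>t. 0 < t \<Longrightarrow> t < d \<Longrightarrow> \<psi> t < \<psi> 0"
    using DERIV_neg_dec_right[of \<psi> "\<sigma> * second_derivative F x z z" 0] neg by auto
  have "open (c -` U)"
    by (rule continuous_open_vimage) (auto simp: U c_def[abs_def] intro!: continuous_intros)
  moreover have "0 \<in> c -` U" using c0 U by simp
  ultimately obtain d' where d': "d' > 0" "ball 0 d' \<subseteq> c -` U" by (rule openE)
  have in_U: "c t \<in> U" if "\<bar>t\<bar> < d'" for t
    using d'(2) that by (auto simp: subset_iff)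
  define t where "t = min d d' / 2"
  have t: "0 < t" "t < d" "t < d'" using d d' by (auto simp: t_def)
  have "\<exists>s>0. s < t \<and> \<sigma> * F (c t) - \<sigma> * F (c 0) = (t - 0) * \<psi> s"
    unfolding \<psi>_def using t by (intro MVT2 along[OF F] in_U) auto
  then obtain s where s: "0 < s" "s < t" "\<sigma> * F (c t) - \<sigma> * F (c 0) = (t - 0) * \<psi> s" by blast
  have "\<psi> s < 0" using d(2)[of s] s t crit c0 by (simp add: \<psi>_def)
  then have "\<sigma> * F (c t) < \<sigma> * F x" using s(3) mult_pos_neg[OF t(1), of "\<psi> s"] c0 by simp
  moreover have "c t \<in> U" using in_U t by simp
  ultimately show False using min by fastforce
qed

section \<open>From charts to manifolds\<close>

lemma smooth_manifold_chart:
  assumes "smooth_manifold M" and "i \<in> cidx M"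
  shows "openin (mtop M) (cdom M i)" and "open (cimg M i)" and "inj_on (cmap M i) (cdom M i)"
    and "continuous_map (subtopology (mtop M) (cdom M i)) (top_of_set (cimg M i)) (cmap M i)"
proof -
  have op: "openin (mtop M) (cdom M i)" and "open (cimg M i)"
    and hom: "homeomorphic_map (subtopology (mtop M) (cdom M i)) (top_of_set (cimg M i)) (cmap M i)"
    using assms unfolding smooth_manifold_def by auto
  then show "openin (mtop M) (cdom M i)" and "open (cimg M i)" by auto
  have "topspace (subtopology (mtop M) (cdom M i)) = cdom M i"
    using openin_subset[OF op] by auto
  then show "inj_on (cmap M i) (cdom M i)"
    using homeomorphic_imp_injective_map[OF hom] by simp
  show "continuous_map (subtopology (mtop M) (cdom M i)) (top_of_set (cimg M i)) (cmap M i)"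
    using hom by (rule homeomorphic_imp_continuous_map)
qed

lemma cimg_mem: "p \<in> cdom M i \<Longrightarrow> cmap M i p \<in> cimg M i"
  by (simp add: cimg_def)

lemma cinv_cmap:
  "smooth_manifold M \<Longrightarrow> i \<in> cidx M \<Longrightarrow> p \<in> cdom M i \<Longrightarrow> cinv M i (cmap M i p) = p"
  unfolding cinv_def by (rule inv_into_f_f[OF smooth_manifold_chart(3)])

lemma cinv_mem: "x \<in> cimg M i \<Longrightarrow> cinv M i x \<in> cdom M i"
  and cmap_cinv: "x \<in> cimg M i \<Longrightarrow> cmap M i (cinv M i x) = x"
  by (auto simp: cinv_def cimg_def inv_into_into f_inv_into_f)

lemma metric_on_in_coords:
  assumes "smooth_manifold M" and "i \<in> cidx M" and "smooth_tensor2 M g"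
    and "\<And>p. p \<in> cdom M i \<Longrightarrow> nondegenerate (g i p)"
  shows "metric_on (in_coords M g i) (cimg M i)"
  unfolding metric_on_def
proof (intro conjI ballI allI)
  show "open (cimg M i)" by (rule smooth_manifold_chart(2)[OF assms(1,2)])
  show "nondegenerate (in_coords M g i x)" if "x \<in> cimg M i" for x
    unfolding in_coords_def by (rule assms(4)[OF cinv_mem[OF that]])
  show "smooth_on (\<lambda>x. in_coords M g i x u v) (cimg M i)" for u v
    using assms(2,3) by (simp add: smooth_tensor2_def)
qed

lemma riemannian_metric_nondegenerate:
  assumes "riemannian_metric M g" and "i \<in> cidx M" and "p \<in> cdom M i"
  shows "nondegenerate (g i p)"
proof -
  have "bilinear (g i p)"
    using assms by (simp add: riemannian_metric_def smooth_tensor2_def)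
  moreover have "g i p u u > 0" if "u \<noteq> 0" for u
    using assms that by (simp add: riemannian_metric_def)
  ultimately show ?thesis unfolding nondegenerate_def by (metis less_irrefl)
qed

lemma semi_riemannian_metric_nondegenerate:
  assumes "semi_riemannian_metric M g" and "i \<in> cidx M" and "p \<in> cdom M i"
  shows "nondegenerate (g i p)"
proof -
  have "bilinear (g i p)"
    using assms by (simp add: semi_riemannian_metric_def smooth_tensor2_def)
  moreover have "u = 0" if "\<forall>v. g i p u v = 0" for u
    using assms that by (simp add: semi_riemannian_metric_def)
  ultimately show ?thesis unfolding nondegenerate_def by blast
qed

text \<open>Smoothness is a condition in charts only, so continuity on the manifold is obtained by
  gluing along the domains of the charts.\<close>

lemma smooth_function_continuous:
  assumes M: "smooth_manifold M" and f: "smooth_function M f"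
  shows "continuous_map (mtop M) euclideanreal f"
proof (rule pasting_lemma)
  show "openin (mtop M) (cdom M i)" if "i \<in> cidx M" for i
    using smooth_manifold_chart(1)[OF M that] .
  show "continuous_map (subtopology (mtop M) (cdom M i)) euclideanreal f" if i: "i \<in> cidx M" for i
  proof -
    have "smooth_on (f \<circ> cinv M i) (cimg M i)" using f i by (simp add: smooth_function_def)
    then have "continuous_on (cimg M i) (f \<circ> cinv M i)"
      by (intro differentiable_imp_continuous_on)
        (auto simp: differentiable_on_def intro: differentiable_at_withinI smooth_on_differentiable)
    then have "continuous_map (top_of_set (cimg M i)) euclideanreal (f \<circ> cinv M i)" by simp
    then have "continuous_map (subtopology (mtop M) (cdom M i)) euclideanreal
        ((f \<circ> cinv M i) \<circ> cmap M i)"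
      by (rule continuous_map_compose[OF smooth_manifold_chart(4)[OF M i]])
    then show ?thesis
      by (rule continuous_map_eq) (auto simp: cinv_cmap[OF M i])
  qed
  show "\<exists>i. i \<in> cidx M \<and> p \<in> cdom M i \<and> f p = f p" if "p \<in> points M" for p
    using M that unfolding smooth_manifold_def by blast
qed simp

lemma smooth_function_attains_extrema:
  assumes M: "smooth_manifold M" and "compact_space (mtop M)" and f: "smooth_function M f"
  obtains p q where "p \<in> points M" "q \<in> points M"
    "\<And>r. r \<in> points M \<Longrightarrow> f p \<le> f r" "\<And>r. r \<in> points M \<Longrightarrow> f r \<le> f q"
proof -
  have "compactin euclideanreal (f ` points M)"
    using assms(2) smooth_function_continuous[OF M f]
    by (intro image_compactin) (auto simp: compact_space_def)
  then have c: "compact (f ` points M)" by simp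
  have ne: "f ` points M \<noteq> {}" using M by (simp add: smooth_manifold_def)
  obtain p q where "p \<in> points M" "q \<in> points M"
    and "\<forall>t\<in>f ` points M. f p \<le> t" "\<forall>t\<in>f ` points M. t \<le> f q"
    using compact_attains_inf[OF c ne] compact_attains_sup[OF c ne] by blast
  then show thesis using that by blast
qed

lemma cinv_product_manifold:
  assumes M: "smooth_manifold M" and N: "smooth_manifold N" and "i \<in> cidx M" "j \<in> cidx N"
    and "x \<in> cimg M i" "y \<in> cimg N j"
  shows "cinv (product_manifold M N) (i, j) (x, y) = (cinv M i x, cinv N j y)"
proof -
  have "inj_on (cmap (product_manifold M N) (i, j)) (cdom (product_manifold M N) (i, j))"
    using smooth_manifold_chart(3)[OF M \<open>i \<in> cidx M\<close>] smooth_manifold_chart(3)[OF N \<open>j \<in> cidx N\<close>]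
    by (auto simp: product_manifold_def inj_on_def)
  then show ?thesis
    unfolding cinv_def[of "product_manifold M N"]
    by (rule inv_into_f_eq) (use assms(5,6) in \<open>auto simp: product_manifold_def cinv_mem cmap_cinv\<close>)
qed

lemma metric_trace_affine:
  fixes B :: "'e::euclidean_space \<Rightarrow> 'e \<Rightarrow> real"
  assumes B: "nondegenerate B" and T: "bilinear T"
  shows "metric_trace B (\<lambda>u v. a * B u v + c * T u v) = a * real DIM('e) + c * metric_trace B T"
proof -
  have bB: "bilinear B" using B by (rule nondegenerate_bilinear)
  have "sharp B (\<lambda>v. a * B u v + c * T u v) = a *\<^sub>R u + c *\<^sub>R sharp B (T u)" for u
    by (rule sharp_eqI[OF B])
      (simp add: bilinear_ladd[OF bB] bilinear_lmul[OF bB] sharp_works[OF B linear_bilinear_right[OF T]])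
  then show ?thesis
    by (simp add: metric_trace_def inner_add_left sum.distrib sum_distrib_left mult.commute)
qed

section \<open>The Einstein equation at an extremum of the warping function\<close>

text \<open>The two halves of the Einstein equation at an extremum \<open>p\<close> of \<open>f\<close>, where \<open>L\<close> is the value of the
  Laplacian of \<open>f\<close>. The horizontal half, traced over the base, gives the scalar curvature;
  the vertical half says that the fiber is Einstein, with a constant expressed through \<open>f p\<close> and \<open>L\<close>.
  The scalar curvature is defined through one particular chart at \<open>p\<close>, and that
  chart is used here; the chart of the fiber is arbitrary.\<close>

lemma einstein_warped_product_at_extremum:
  fixes M :: "('a, 'i, 'e::euclidean_space) atlas"
    and N :: "('b, 'j, 'd::euclidean_space) atlas"
  assumes M: "smooth_manifold M" and g: "riemannian_metric M g"
    and N: "smooth_manifold N" and h: "semi_riemannian_metric N h"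
    and f: "smooth_function M f" and pos: "\<forall>p\<in>points M. f p > 0"
    and ein: "einstein (product_manifold M N) (warped_metric g f h) lam"
    and p: "p \<in> points M" and "\<sigma> \<noteq> 0" and ext: "\<And>r. r \<in> points M \<Longrightarrow> \<sigma> * f p \<le> \<sigma> * f r"
  obtains L where "\<sigma> * L \<ge> 0"
    and "scalar_curvature M g p = lam * real DIM('e) + real DIM('d) / f p * L"
    and "\<And>j q u v. j \<in> cidx N \<Longrightarrow> q \<in> cdom N j \<Longrightarrow>
      ricci N h j q u v = (lam * (f p)\<^sup>2 + f p * L) * h j q u v"
proof -
  define i where "i = chart_at M p"
  have "\<exists>i. i \<in> cidx M \<and> p \<in> cdom M i" using M p unfolding smooth_manifold_def by blast
  then have "i \<in> cidx M \<and> p \<in> cdom M i" unfolding i_def chart_at_def by (rule someI_ex)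
  then have i: "i \<in> cidx M" and pi: "p \<in> cdom M i" by auto
  define x where "x = cmap M i p"
  define F where "F = f \<circ> cinv M i"
  define G where "G = in_coords M g i"
  define U where "U = cimg M i"
  have x: "x \<in> U" and cx: "cinv M i x = p"
    using pi cinv_cmap[OF M i] by (auto simp: U_def x_def cimg_mem)
  have Fx: "F x = f p" and Gx: "G x = g i p" by (simp_all add: F_def G_def in_coords_def cx)
  have cdom_points: "cdom M i \<subseteq> points M"
    using openin_subset[OF smooth_manifold_chart(1)[OF M i]] .
  have F: "smooth_on F U" using f i by (simp add: smooth_function_def F_def U_def)
  have F_pos: "F z > 0" if "z \<in> U" for z
    using pos cdom_points cinv_mem[OF that[unfolded U_def]] by (auto simp: F_def)
  have F_ext: "\<sigma> * F x \<le> \<sigma> * F z" if "z \<in> U" for z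
    unfolding Fx using ext cdom_points cinv_mem[OF that[unfolded U_def]] by (auto simp: F_def)
  have G: "metric_on G U"
    unfolding G_def U_def
    by (rule metric_on_in_coords[OF M i])
      (use g i in \<open>auto simp: riemannian_metric_def intro: riemannian_metric_nondegenerate[OF g]\<close>)
  have U: "open U" using metric_onD(1)[OF G] .
  have crit: "frechet_derivative F (at x) = (\<lambda>z. 0)"
    by (rule derivative_zero_at_extremum[OF F U x \<open>\<sigma> \<noteq> 0\<close> F_ext])
  define L where "L = metric_trace (G x) (second_derivative F x)"
  have bF: "bilinear (second_derivative F x)" by (rule bilinear_second_derivative[OF F U x])
  have formula: "local_ricci G x u v - real DIM('d) / f p * second_derivative F x u v
      + ricci N h j q u' v' - f p * L * h j q u' v'
      = lam * (g i p u v + (f p)\<^sup>2 * h j q u' v')"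
    and zero: "ricci N h j q 0 0 = 0" "h j q 0 0 = 0"
    if j: "j \<in> cidx N" and q: "q \<in> cdom N j" for j q u v u' v'
  proof -
    define y where "y = cmap N j q"
    define H where "H = in_coords N h j"
    define V where "V = cimg N j"
    define K where "K = in_coords (product_manifold M N) (warped_metric g f h) (i, j)"
    have y: "y \<in> V" and cy: "cinv N j y = q"
      using q cinv_cmap[OF N j] by (auto simp: V_def y_def cimg_mem)
    have Hy: "H y = h j q" by (simp add: H_def in_coords_def cy)
    have H: "metric_on H V"
      unfolding H_def V_def
      by (rule metric_on_in_coords[OF N j])
        (use h j in \<open>auto simp: semi_riemannian_metric_def intro: semi_riemannian_metric_nondegenerate[OF h]\<close>)
    interpret local_warped_product G U H V F K
    proof
      show "K (a, b) (u, u') (v, v') = G a u v + (F a)\<^sup>2 * H b u' v'"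
        if "a \<in> U" "b \<in> V" for a b u u' v v'
        using that cinv_product_manifold[OF M N i j]
        by (simp add: K_def G_def H_def F_def U_def V_def in_coords_def warped_metric_def)
    qed (fact G H F F_pos)+
    have "lam * (g i p u v + (f p)\<^sup>2 * h j q u' v')
        = ricci (product_manifold M N) (warped_metric g f h) (i, j) (p, q) (u, u') (v, v')"
      using ein i j pi q unfolding einstein_def by (auto simp: product_manifold_def warped_metric_def)
    also have "\<dots> = local_ricci K (x, y) (u, u') (v, v')"
      by (simp add: ricci_def K_def x_def y_def product_manifold_def)
    also have "\<dots> = local_ricci G x u v - real DIM('d) / f p * second_derivative F x u v
      + local_ricci H y u' v' - f p * L * h j q u' v'"
      by (simp add: local_ricci_K_critical[OF x y crit] Fx Hy L_def)
    finally show "local_ricci G x u v - real DIM('d) / f p * second_derivative F x u v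
      + ricci N h j q u' v' - f p * L * h j q u' v'
      = lam * (g i p u v + (f p)\<^sup>2 * h j q u' v')"
      by (simp add: ricci_def H_def y_def)
    show "ricci N h j q 0 0 = 0"
      using local_ricci_zero[OF H y] by (simp add: ricci_def H_def y_def)
    show "h j q 0 0 = 0"
      using metric_onD(3)[OF H y] by (simp add: Hy bilinear_lzero)
  qed
  show thesis
  proof (rule that[of L])
    show "\<sigma> * L \<ge> 0"
      unfolding L_def
    proof (rule metric_trace_nonneg[OF metric_onD(3)[OF G x] _ _ bF])
      show "G x u v = G x v u" for u v
        using g i pi by (auto simp: Gx riemannian_metric_def symmetric_tensor2_def)
      show "G x u u > 0" if "u \<noteq> 0" for u
        using g i pi that by (auto simp: Gx riemannian_metric_def)
      show "\<sigma> * second_derivative F x u u \<ge> 0" for u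
        by (rule second_derivative_at_extremum[OF F U x \<open>\<sigma> \<noteq> 0\<close> F_ext])
    qed
    obtain j q where jq: "j \<in> cidx N" "q \<in> cdom N j"
      using N unfolding smooth_manifold_def by blast
    \<comment> \<open>The horizontal half: zero vectors are inserted in the fiber directions.\<close>
    have "ricci M g i p = (\<lambda>u v. lam * g i p u v + real DIM('d) / f p * second_derivative F x u v)"
      using formula[OF jq, of _ _ 0 0] zero[OF jq]
      by (simp add: fun_eq_iff ricci_def G_def x_def algebra_simps)
    then have "scalar_curvature M g p
        = metric_trace (G x) (\<lambda>u v. lam * G x u v + real DIM('d) / f p * second_derivative F x u v)"
      by (simp add: scalar_curvature_def i_def[symmetric] Gx)
    also have "\<dots> = lam * real DIM('e) + real DIM('d) / f p * L"
      unfolding L_def by (rule metric_trace_affine[OF metric_onD(2)[OF G x] bF])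
    finally show "scalar_curvature M g p = lam * real DIM('e) + real DIM('d) / f p * L" .
    \<comment> \<open>The vertical half: zero vectors are inserted in the base directions.\<close>
    have "local_ricci G x 0 0 = 0" "second_derivative F x 0 0 = 0" "g i p 0 0 = 0"
      using local_ricci_zero[OF G x] bF metric_onD(3)[OF G x] by (auto simp: bilinear_lzero Gx)
    then show "ricci N h j q u v = (lam * (f p)\<^sup>2 + f p * L) * h j q u v"
      if "j \<in> cidx N" "q \<in> cdom N j" for j q u v
      using formula[OF that, of 0 0 u v] by (simp add: algebra_simps)
  qed
qed

section \<open>Triviality of the warping function\<close>

theorem theorem2:
  fixes M :: "('a, 'i, 'e::euclidean_space) atlas"
    and N :: "('b, 'j, 'd::euclidean_space) atlas"
    and g :: "('a, 'i, 'e) tensor2"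
    and h :: "('b, 'j, 'd) tensor2"
    and f :: "'a \<Rightarrow> real"
    and lam :: real
  assumes "DIM('e) \<ge> 3" and "DIM('d) \<ge> 2"
    and "smooth_manifold M" and "compact_space (mtop M)" and "riemannian_metric M g"
    and "smooth_manifold N" and "semi_riemannian_metric N h"
    and "smooth_function M f" and "\<forall>p\<in>points M. f p > 0"
    and "einstein (product_manifold M N) (warped_metric g f h) lam" and "lam \<noteq> 0"
    and "\<forall>p\<in>points M. scalar_curvature M g p \<le> lam * (real DIM('e) - real DIM('d))"
  shows "(\<exists>c. \<forall>p\<in>points M. f p = c) \<and>
    ((\<forall>p\<in>points M. scalar_curvature M g p = lam * (real DIM('e) - real DIM('d)))
      \<longrightarrow> ricci_flat N h)"
proof -
  obtain p\<^sub>0 p\<^sub>1 where p: "p\<^sub>0 \<in> points M" "p\<^sub>1 \<in> points M"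
    and min: "\<And>r. r \<in> points M \<Longrightarrow> f p\<^sub>0 \<le> f r" and max: "\<And>r. r \<in> points M \<Longrightarrow> f r \<le> f p\<^sub>1"
    using smooth_function_attains_extrema[OF assms(3,4,8)] by blast
  note at_extremum = einstein_warped_product_at_extremum[OF assms(3,5,6,7,8,9,10)]
  obtain L\<^sub>0 where L0: "L\<^sub>0 \<ge> 0"
    and R0: "scalar_curvature M g p\<^sub>0 = lam * real DIM('e) + real DIM('d) / f p\<^sub>0 * L\<^sub>0"
    and Ric0: "\<And>j q u v. j \<in> cidx N \<Longrightarrow> q \<in> cdom N j \<Longrightarrow>
      ricci N h j q u v = (lam * (f p\<^sub>0)\<^sup>2 + f p\<^sub>0 * L\<^sub>0) * h j q u v"
  proof (rule at_extremum[OF p(1), of 1])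
    fix L assume "1 * L \<ge> 0" and "scalar_curvature M g p\<^sub>0 = lam * real DIM('e) + real DIM('d) / f p\<^sub>0 * L"
      and "\<And>j q u v. j \<in> cidx N \<Longrightarrow> q \<in> cdom N j \<Longrightarrow>
        ricci N h j q u v = (lam * (f p\<^sub>0)\<^sup>2 + f p\<^sub>0 * L) * h j q u v"
    then show thesis by (intro that[of L]) auto
  qed (use min in auto)
  obtain L\<^sub>1 where L1: "L\<^sub>1 \<le> 0"
    and R1: "scalar_curvature M g p\<^sub>1 = lam * real DIM('e) + real DIM('d) / f p\<^sub>1 * L\<^sub>1"
    and Ric1: "\<And>j q u v. j \<in> cidx N \<Longrightarrow> q \<in> cdom N j \<Longrightarrow>
      ricci N h j q u v = (lam * (f p\<^sub>1)\<^sup>2 + f p\<^sub>1 * L\<^sub>1) * h j q u v"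
  proof (rule at_extremum[OF p(2), of "-1"])
    fix L assume "- 1 * L \<ge> 0" and "scalar_curvature M g p\<^sub>1 = lam * real DIM('e) + real DIM('d) / f p\<^sub>1 * L"
      and "\<And>j q u v. j \<in> cidx N \<Longrightarrow> q \<in> cdom N j \<Longrightarrow>
        ricci N h j q u v = (lam * (f p\<^sub>1)\<^sup>2 + f p\<^sub>1 * L) * h j q u v"
    then show thesis by (intro that[of L]) auto
  qed (use max in auto)
  have f0: "f p\<^sub>0 > 0" and f1: "f p\<^sub>1 > 0" using p assms(9) by auto
  have m: "real DIM('d) > 0" by simp
  \<comment> \<open>For positive \<open>lam\<close> the scalar curvature at the minimum would exceed the assumed bound.\<close>
  have "lam < 0"
  proof (rule ccontr)
    assume "\<not> lam < 0"
    then have "lam * real DIM('d) > 0" using \<open>lam \<noteq> 0\<close> m by simp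
    moreover have "real DIM('d) / f p\<^sub>0 * L\<^sub>0 \<ge> 0" using f0 L0 by simp
    moreover have "scalar_curvature M g p\<^sub>0 \<le> lam * real DIM('e) - lam * real DIM('d)"
      using assms(12) p(1) by (simp add: right_diff_distrib)
    ultimately show False using R0 by linarith
  qed
  obtain j q where jq: "j \<in> cidx N" "q \<in> cdom N j"
    using assms(6) unfolding smooth_manifold_def by blast
  have "nondegenerate (h j q)" by (rule semi_riemannian_metric_nondegenerate[OF assms(7) jq])
  \<comment> \<open>The Einstein constant of the fiber is seen from both extrema, hence its two values agree.\<close>
  then obtain u v where "h j q u v \<noteq> 0"
    unfolding nondegenerate_def using nonzero_Basis[OF SOME_Basis] by blast
  then have "lam * (f p\<^sub>0)\<^sup>2 + f p\<^sub>0 * L\<^sub>0 = lam * (f p\<^sub>1)\<^sup>2 + f p\<^sub>1 * L\<^sub>1"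
    using Ric0[OF jq, of u v] Ric1[OF jq, of u v] by simp
  moreover have "f p\<^sub>0 * L\<^sub>0 \<ge> 0" and "f p\<^sub>1 * L\<^sub>1 \<le> 0"
    using f0 f1 L0 L1 by (auto simp: mult_le_0_iff)
  ultimately have "lam * (f p\<^sub>0)\<^sup>2 \<le> lam * (f p\<^sub>1)\<^sup>2" by linarith
  then have "(f p\<^sub>1)\<^sup>2 \<le> (f p\<^sub>0)\<^sup>2" using \<open>lam < 0\<close> by simp
  then have "f p\<^sub>1 \<le> f p\<^sub>0" using f0 by (rule power2_le_imp_le[OF _ less_imp_le])
  then have const: "\<forall>r\<in>points M. f r = f p\<^sub>0" using min max by (blast intro: order.antisym order.trans)
  \<comment> \<open>With \<open>lam\<close> negative, equality in the curvature bound already fails at the maximum.\<close>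
  have "real DIM('d) / f p\<^sub>1 * L\<^sub>1 \<le> 0" using f1 L1 by (simp add: mult_le_0_iff divide_le_0_iff)
  moreover have "lam * real DIM('d) < 0" using \<open>lam < 0\<close> m by (rule mult_neg_pos)
  ultimately have "scalar_curvature M g p\<^sub>1 < lam * (real DIM('e) - real DIM('d))"
    using R1 right_diff_distrib[of lam "real DIM('e)" "real DIM('d)"] by linarith
  then have "\<not> (\<forall>p\<in>points M. scalar_curvature M g p = lam * (real DIM('e) - real DIM('d)))"
    using p(2) by (metis less_irrefl)
  then show ?thesis using const by blast
qed

end
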